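(* Let $k\in\mathbb{N}$, let $\mathcal{G}$ be a graph class (with a membership test) containing only cubic graphs, all with at least $k+1$ vertices, and let $\mathcal{U}$ be a finite set of graphs. Consider the symmetry-breaking algorithm described in the context, modified as follows: whenever a pair $(U,H)$ is processed such that $U$ contains a vertex of degree at least $2$ in $H$, then in step (b), instead of iterating over a set $\overline{U}$ of representatives of all orbits, only a single (arbitrarily chosen) vertex $u\in U$ with $\deg_H(u)\ge 2$ is considered. Then the modified algorithm is still correct: if it returns a graph, this graph is in $\mathcal{G}^k\setminus\mathrm{super}(\mathcal{U})$, and if it returns NONE, then $\mathcal{G}^k\subseteq\mathrm{super}(\mathcal{U})$.
   Context: Graphs are non-empty, finite and simple; graph classes are closed under isomorphism. A path-decomposition of $G$ is a sequence of bags $V_1,\dots,V_{n'}\subseteq V(G)$ such that every vertex lies in some bag, both ends of every edge lie together in some bag, and for each vertex the indices of the bags containing it form an interval. Its width is $\max_i|V_i|-1$; path-width is the minimum width. A path-decomposition of width $k$ is smooth if all bags have $k+1$ elements and $|V_i\cap V_{i+1}|=k$ for $1\le i<n'$. The graph associated with $V_i$ is $G_i := G[\bigcup_{1\le j\le i}V_j]-E(G[V_i])$. $\mathcal{G}^k$ is the class of graphs in $\mathcal{G}$ of path-width at most $k$; $\mathrm{super}(\mathcal{U})$ is the class of all graphs that contain a subgraph isomorphic to some member of $\mathcal{U}$. For a smooth path-decomposition (of width $k$) of $G$ with bags $V_1,\dots,V_{n'}$ and each $i$, we say that $G$ contains the pair $(V_i,G_i)$. A pair $(U,H)$ is good if every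 $G\in\mathcal{G}^k$ containing it satisfies $G\in\mathrm{super}(\mathcal{U})$. $\mathrm{Aut}(U,H)$ denotes the group of automorphisms $\varphi$ of $H$ with $\varphi(U)=U$. Symmetry-breaking algorithm, with vertices named $u_1,\dots,u_k,v_1,v_2,\dots$: 1. Set $V_1:=\{u_1,\dots,u_k,v_1\}$ and initialise a queue $Q$ with the single pair $(V_1,(V_1,\emptyset))$, where $(V_1,\emptyset)$ is the edgeless graph on $V_1$. If this pair is good, remove it from $Q$. 2. While $Q$ is not empty: remove a pair $(U,H)$ from $Q$ and determine $\mathrm{Aut}(U,H)$. (a) Let $\mathcal{F}$ be the set of all subsets of $\{xy:x,y\in U,x\neq y\}$. While $\mathcal{F}\neq\emptyset$: remove some $E'$ from $\mathcal{F}$; if $H+E'\in\mathcal{G}\setminus\mathrm{super}(\mathcal{U})$, return $H+E'$ and stop; otherwise remove all sets $\varphi(E')$, $\varphi\in\mathrm{Aut}(U,H)$, from $\mathcal{F}$. (b) Let $i=|V(H)|-k$ and let $\overline{U}\subseteq U$ contain one vertex from every orbit of $\mathrm{Aut}(U,H)$ on $U$. For each $u\in\overline{U}$: set $U':=(U\setminus\{u\})\cup\{v_{i+1}\}$ and let $\mathcal{Y}$ be the set of all subsets of $U\setminus\{u\}$. While $\mathcal{Y}\neq\emptyset$: remove some $Y$ from $\mathcal{Y}$; set $H':=H+v_{i+1}+\{uy:y\in Y\}$; if $H'\notin\mathrm{super}(\mathcal{U})$, and there exists $G\in\mathcal{G}$ containing $(U',H')$, and there is no bijection $\varphi$ with $(\varphi(U'),\varphi(H'))\in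 Q$, then append $(U',H')$ to $Q$; then remove all sets $\varphi(Y)$ with $\varphi\in\mathrm{Aut}(U,H)$, $\varphi(u)=u$, from $\mathcal{Y}$. 3. Return NONE. *)

theory Defs
  imports "HOL-Combinatorics.Permutations"
begin

datatype 'a graph = Graph (verts: "'a set") (edges: "'a set set")

definition simple_graph :: "'a graph \<Rightarrow> bool" where
  "simple_graph G \<longleftrightarrow> finite (verts G) \<and> verts G \<noteq> {} \<and>
     (\<forall>e\<in>edges G. \<exists>x\<in>verts G. \<exists>y\<in>verts G. x \<noteq> y \<and> e = {x, y})"

definition degree :: "'a graph \<Rightarrow> 'a \<Rightarrow> nat" where
  "degree G x = card {e \<in> edges G. x \<in> e}"

definition cubic :: "'a graph \<Rightarrow> bool" where
  "cubic G \<longleftrightarrow> (\<forall>x\<in>verts G. degree G x = 3)"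

definition subgraph :: "'a graph \<Rightarrow> 'a graph \<Rightarrow> bool" where
  "subgraph S G \<longleftrightarrow> simple_graph S \<and> verts S \<subseteq> verts G \<and> edges S \<subseteq> edges G"

definition induced_subgraph :: "'a graph \<Rightarrow> 'a set \<Rightarrow> 'a graph" where
  "induced_subgraph G S = Graph (verts G \<inter> S) {e \<in> edges G. e \<subseteq> S}"

definition add_edges :: "'a graph \<Rightarrow> 'a set set \<Rightarrow> 'a graph" where
  "add_edges G E = Graph (verts G) (edges G \<union> E)"

definition del_edges :: "'a graph \<Rightarrow> 'a set set \<Rightarrow> 'a graph" where
  "del_edges G E = Graph (verts G) (edges G - E)"

definition add_vertex :: "'a graph \<Rightarrow> 'a \<Rightarrow> 'a graph" where
  "add_vertex G x = Graph (insert x (verts G)) (edges G)"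

definition image_graph :: "('a \<Rightarrow> 'a) \<Rightarrow> 'a graph \<Rightarrow> 'a graph" where
  "image_graph f G = Graph (f ` verts G) ((`) f ` edges G)"

definition graph_iso :: "('a \<Rightarrow> 'a) \<Rightarrow> 'a graph \<Rightarrow> 'a graph \<Rightarrow> bool" where
  "graph_iso f G H \<longleftrightarrow> bij_betw f (verts G) (verts H) \<and> image_graph f G = H"

definition isomorphic :: "'a graph \<Rightarrow> 'a graph \<Rightarrow> bool" where
  "isomorphic G H \<longleftrightarrow> (\<exists>f. graph_iso f G H)"

definition graph_class :: "'a graph set \<Rightarrow> bool" where
  "graph_class \<G> \<longleftrightarrow> (\<forall>G\<in>\<G>. simple_graph G) \<and>
     (\<forall>G\<in>\<G>. \<forall>H. isomorphic G H \<longrightarrow> H \<in> \<G>)"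

definition super :: "'a graph set \<Rightarrow> 'a graph set" where
  "super \<U> = {G. simple_graph G \<and> (\<exists>F\<in>\<U>. \<exists>S. subgraph S G \<and> isomorphic F S)}"


text \<open>Bags are indexed from 0, so the bag \<open>V\<^sub>i\<close> of the usual notation is \<open>Vs ! (i - 1)\<close>.\<close>

definition path_decomposition :: "'a graph \<Rightarrow> 'a set list \<Rightarrow> bool" where
  "path_decomposition G Vs \<longleftrightarrow>
     (\<forall>B\<in>set Vs. B \<subseteq> verts G) \<and>
     (\<forall>x\<in>verts G. \<exists>B\<in>set Vs. x \<in> B) \<and>
     (\<forall>e\<in>edges G. \<exists>B\<in>set Vs. e \<subseteq> B) \<and>
     (\<forall>x\<in>verts G. \<forall>i j l. i \<le> j \<and> j \<le> l \<and> l < length Vs \<and> x \<in> Vs ! i \<and> x \<in> Vs ! l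
        \<longrightarrow> x \<in> Vs ! j)"

definition width :: "'a set list \<Rightarrow> nat" where
  "width Vs = Max (card ` set Vs) - 1"

definition path_width :: "'a graph \<Rightarrow> nat" where
  "path_width G = (LEAST w. \<exists>Vs. path_decomposition G Vs \<and> width Vs = w)"

definition smooth_path_decomposition :: "nat \<Rightarrow> 'a graph \<Rightarrow> 'a set list \<Rightarrow> bool" where
  "smooth_path_decomposition k G Vs \<longleftrightarrow>
     path_decomposition G Vs \<and> width Vs = k \<and>
     (\<forall>B\<in>set Vs. card B = k + 1) \<and>
     (\<forall>i. Suc i < length Vs \<longrightarrow> card (Vs ! i \<inter> Vs ! Suc i) = k)"

definition associated_graph :: "'a graph \<Rightarrow> 'a set list \<Rightarrow> nat \<Rightarrow> 'a graph" where
  "associated_graph G Vs i =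
     del_edges (induced_subgraph G (\<Union>j\<le>i. Vs ! j)) (edges (induced_subgraph G (Vs ! i)))"

definition contains_pair :: "nat \<Rightarrow> 'a graph \<Rightarrow> 'a set \<times> 'a graph \<Rightarrow> bool" where
  "contains_pair k G p \<longleftrightarrow>
     (\<exists>Vs i. smooth_path_decomposition k G Vs \<and> i < length Vs \<and>
        p = (Vs ! i, associated_graph G Vs i))"

definition class_pw :: "'a graph set \<Rightarrow> nat \<Rightarrow> 'a graph set" where
  "class_pw \<G> k = {G \<in> \<G>. path_width G \<le> k}"

definition good_pair :: "nat \<Rightarrow> 'a graph set \<Rightarrow> 'a graph set \<Rightarrow> 'a set \<times> 'a graph \<Rightarrow> bool" where
  "good_pair k \<G> \<U> p \<longleftrightarrow> (\<forall>G\<in>class_pw \<G> k. contains_pair k G p \<longrightarrow> G \<in> super \<U>)"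

definition Aut :: "'a set \<Rightarrow> 'a graph \<Rightarrow> ('a \<Rightarrow> 'a) set" where
  "Aut U H = {\<phi>. \<phi> permutes verts H \<and> graph_iso \<phi> H H \<and> \<phi> ` U = U}"

definition Aut_orbit :: "'a set \<Rightarrow> 'a graph \<Rightarrow> 'a \<Rightarrow> 'a set" where
  "Aut_orbit U H x = (\<lambda>\<phi>. \<phi> x) ` Aut U H"

definition orbit_representatives :: "'a set \<Rightarrow> 'a graph \<Rightarrow> 'a set \<Rightarrow> bool" where
  "orbit_representatives U H W \<longleftrightarrow>
     W \<subseteq> U \<and> (\<forall>x\<in>U. \<exists>!w. w \<in> W \<and> w \<in> Aut_orbit U H x)"

definition pair_iso :: "'a set \<times> 'a graph \<Rightarrow> 'a set \<times> 'a graph \<Rightarrow> bool" where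
  "pair_iso p q \<longleftrightarrow> (\<exists>\<phi>. graph_iso \<phi> (snd p) (snd q) \<and> \<phi> ` fst p = fst q)"


text \<open>
  The algorithm is nondeterministic. It is described by big-step relations that relate the state
  before a loop to every possible outcome of that loop, one outcome for each way of resolving the
  choices. The result \<open>Some G\<close> means that the graph \<open>G\<close> is returned; in \<open>edge_loop\<close>,
  \<open>None\<close> means that the loop ends without returning a graph, and in \<open>main_loop\<close> and
  \<open>algorithm_returns\<close> it is the answer NONE.
\<close>

inductive edge_loop ::
  "'a graph set \<Rightarrow> 'a graph set \<Rightarrow> 'a set \<Rightarrow> 'a graph \<Rightarrow> 'a set set set \<Rightarrow> 'a graph option \<Rightarrow> bool"
  for \<G> \<U> U H where
  finish: "edge_loop \<G> \<U> U H {} None"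
| return: "E' \<in> F \<Longrightarrow> add_edges H E' \<in> \<G> - super \<U> \<Longrightarrow>
    edge_loop \<G> \<U> U H F (Some (add_edges H E'))"
| continue: "E' \<in> F \<Longrightarrow> add_edges H E' \<notin> \<G> - super \<U> \<Longrightarrow>
    edge_loop \<G> \<U> U H (F - {E'} - {(`) \<phi> ` E' | \<phi>. \<phi> \<in> Aut U H}) r \<Longrightarrow>
    edge_loop \<G> \<U> U H F r"

definition queue_update ::
  "nat \<Rightarrow> 'a graph set \<Rightarrow> 'a graph set \<Rightarrow> 'a set \<times> 'a graph \<Rightarrow> ('a set \<times> 'a graph) list
    \<Rightarrow> ('a set \<times> 'a graph) list" where
  "queue_update k \<G> \<U> p Q =
     (if snd p \<notin> super \<U> \<and> (\<exists>G\<in>\<G>. contains_pair k G p) \<and> \<not> (\<exists>q\<in>set Q. pair_iso p q)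
      then Q @ [p] else Q)"

text \<open>
  In the next two relations \<open>x\<close> is the fresh vertex, and the last two arguments are the queue
  before and after the loop.
\<close>

inductive neighbourhood_loop ::
  "nat \<Rightarrow> 'a graph set \<Rightarrow> 'a graph set \<Rightarrow> 'a set \<Rightarrow> 'a graph \<Rightarrow> 'a \<Rightarrow> 'a \<Rightarrow> 'a set set
    \<Rightarrow> ('a set \<times> 'a graph) list \<Rightarrow> ('a set \<times> 'a graph) list \<Rightarrow> bool"
  for k \<G> \<U> U H x u where
  finish: "neighbourhood_loop k \<G> \<U> U H x u {} Q Q"
| continue: "Y \<in> \<Y> \<Longrightarrow>
    U' = insert x (U - {u}) \<Longrightarrow>
    H' = add_edges (add_vertex H x) {{u, y} | y. y \<in> Y} \<Longrightarrow>
    neighbourhood_loop k \<G> \<U> U H x u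
      (\<Y> - {Y} - {\<phi> ` Y | \<phi>. \<phi> \<in> Aut U H \<and> \<phi> u = u}) (queue_update k \<G> \<U> (U', H') Q) Q' \<Longrightarrow>
    neighbourhood_loop k \<G> \<U> U H x u \<Y> Q Q'"

inductive vertex_loop ::
  "nat \<Rightarrow> 'a graph set \<Rightarrow> 'a graph set \<Rightarrow> 'a set \<Rightarrow> 'a graph \<Rightarrow> 'a \<Rightarrow> 'a set
    \<Rightarrow> ('a set \<times> 'a graph) list \<Rightarrow> ('a set \<times> 'a graph) list \<Rightarrow> bool"
  for k \<G> \<U> U H x where
  finish: "vertex_loop k \<G> \<U> U H x {} Q Q"
| continue: "u \<in> W \<Longrightarrow>
    neighbourhood_loop k \<G> \<U> U H x u (Pow (U - {u})) Q Q' \<Longrightarrow>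
    vertex_loop k \<G> \<U> U H x (W - {u}) Q' Q'' \<Longrightarrow>
    vertex_loop k \<G> \<U> U H x W Q Q''"

text \<open>
  The admissible sets of vertices \<open>u\<close> to be replaced in the bag \<open>U\<close>. The unmodified
  symmetry-breaking algorithm always uses \<open>orbit_representatives U H W\<close>.
\<close>

definition branching_set :: "'a set \<Rightarrow> 'a graph \<Rightarrow> 'a set \<Rightarrow> bool" where
  "branching_set U H W \<longleftrightarrow>
     (if \<exists>u\<in>U. degree H u \<ge> 2 then \<exists>u\<in>U. degree H u \<ge> 2 \<and> W = {u}
      else orbit_representatives U H W)"

text \<open>
  Any pair may be removed from the queue, not just the first one, so every queueing discipline is
  covered. Fresh vertices are \<open>v 1, v 2, \<dots>\<close>.
\<close>

inductive main_loop ::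
  "nat \<Rightarrow> 'a graph set \<Rightarrow> 'a graph set \<Rightarrow> (nat \<Rightarrow> 'a) \<Rightarrow> ('a set \<times> 'a graph) list
    \<Rightarrow> 'a graph option \<Rightarrow> bool"
  for k \<G> \<U> v where
  finish: "main_loop k \<G> \<U> v [] None"
| return: "edge_loop \<G> \<U> U H (Pow {{x, y} | x y. x \<in> U \<and> y \<in> U \<and> x \<noteq> y}) (Some G) \<Longrightarrow>
    main_loop k \<G> \<U> v (Q1 @ (U, H) # Q2) (Some G)"
| continue: "edge_loop \<G> \<U> U H (Pow {{x, y} | x y. x \<in> U \<and> y \<in> U \<and> x \<noteq> y}) None \<Longrightarrow>
    i = card (verts H) - k \<Longrightarrow>
    branching_set U H W \<Longrightarrow>
    vertex_loop k \<G> \<U> U H (v (i + 1)) W (Q1 @ Q2) Q' \<Longrightarrow>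
    main_loop k \<G> \<U> v Q' r \<Longrightarrow>
    main_loop k \<G> \<U> v (Q1 @ (U, H) # Q2) r"

definition initial_queue ::
  "nat \<Rightarrow> 'a graph set \<Rightarrow> 'a graph set \<Rightarrow> (nat \<Rightarrow> 'a) \<Rightarrow> (nat \<Rightarrow> 'a)
    \<Rightarrow> ('a set \<times> 'a graph) list" where
  "initial_queue k \<G> \<U> u v =
     (let V\<^sub>1 = insert (v 1) (u ` {1..k}); p = (V\<^sub>1, Graph V\<^sub>1 {})
      in if good_pair k \<G> \<U> p then [] else [p])"

definition algorithm_returns ::
  "nat \<Rightarrow> 'a graph set \<Rightarrow> 'a graph set \<Rightarrow> (nat \<Rightarrow> 'a) \<Rightarrow> (nat \<Rightarrow> 'a)
    \<Rightarrow> 'a graph option \<Rightarrow> bool" where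
  "algorithm_returns k \<G> \<U> u v r \<longleftrightarrow> main_loop k \<G> \<U> v (initial_queue k \<G> \<U> u v) r"

end

theory Submission
  imports Defs
begin

text \<open>
  A pair on which the algorithm must not fail is called promising: some \<open>G \<in> \<G> - super \<U>\<close> contains it
  through the initial part of a smooth path-decomposition that can be completed. If \<open>(U, H)\<close> is
  promising and \<open>H\<close> plus edges inside \<open>U\<close> is never a counterexample, then some vertex of \<open>U\<close> can be
  replaced so that the new pair is promising again, and this property is invariant under renaming of
  vertices. So a promising pair in the queue would always leave a promising pair behind, and the
  queue could never become empty.

  If \<open>y \<in> U\<close> has degree at least 2 in \<open>H\<close>, then \<open>y\<close> itself can be replaced. It has at most one
  neighbour \<open>w\<close> outside \<open>H\<close>. If there is none, \<open>y\<close> may simply leave the bag now. Otherwise \<open>w\<close> is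
  exchanged with the vertex \<open>x\<close> introduced last, which is isolated in \<open>H\<close>: the pair stays the same
  up to isomorphism, all neighbours of \<open>y\<close> are now present, and in later bags \<open>w\<close> takes the place
  that was occupied by \<open>y\<close>, so that \<open>x\<close> fits in as well.
\<close>

section \<open>Images of graphs\<close>

lemma edge_subset_verts: "simple_graph G \<Longrightarrow> e \<in> edges G \<Longrightarrow> e \<subseteq> verts G"
  by (metis empty_subsetI insert_subset simple_graph_def)

lemma verts_image_graph [simp]: "verts (image_graph f G) = f ` verts G"
  and edges_image_graph [simp]: "edges (image_graph f G) = (`) f ` edges G"
  by (simp_all add: image_graph_def)

lemma verts_add_edges [simp]: "verts (add_edges G E) = verts G"
  and edges_add_edges [simp]: "edges (add_edges G E) = edges G \<union> E"
  by (simp_all add: add_edges_def)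

lemma verts_add_vertex [simp]: "verts (add_vertex G x) = insert x (verts G)"
  and edges_add_vertex [simp]: "edges (add_vertex G x) = edges G"
  by (simp_all add: add_vertex_def)

lemma graph_eqI: "verts G = verts H \<Longrightarrow> edges G = edges H \<Longrightarrow> G = H"
  by (cases G; cases H) simp

lemma image_graph_comp: "image_graph f (image_graph g G) = image_graph (f \<circ> g) G"
  by (rule graph_eqI) (simp_all add: image_image image_comp)

lemma image_graph_cong:
  assumes "\<Union> (edges G) \<subseteq> verts G" "\<And>x. x \<in> verts G \<Longrightarrow> f x = g x"
  shows "image_graph f G = image_graph g G"
proof (rule graph_eqI)
  show "verts (image_graph f G) = verts (image_graph g G)"
    using assms(2) by simp
  have "f ` e = g ` e" if "e \<in> edges G" for e
    using assms that by (intro image_cong) auto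
  then show "edges (image_graph f G) = edges (image_graph g G)"
    by simp
qed

lemma image_graph_id [simp]: "image_graph id G = G"
  by (rule graph_eqI) (simp_all add: image_def)

lemma simple_graph_image:
  assumes "simple_graph G" "inj_on f (verts G)"
  shows "simple_graph (image_graph f G)"
  unfolding simple_graph_def
proof (intro conjI ballI)
  show "finite (verts (image_graph f G))" "verts (image_graph f G) \<noteq> {}"
    using assms(1) by (auto simp: simple_graph_def)
  fix e assume "e \<in> edges (image_graph f G)"
  then obtain e' where "e' \<in> edges G" "e = f ` e'" by auto
  moreover from this have "\<exists>x\<in>verts G. \<exists>y\<in>verts G. x \<noteq> y \<and> e' = {x, y}"
    using assms(1) by (simp add: simple_graph_def)
  ultimately obtain x y where "x \<in> verts G" "y \<in> verts G" "x \<noteq> y" "e = f ` {x, y}" by blast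
  then have "f x \<in> verts (image_graph f G)" "f y \<in> verts (image_graph f G)" "f x \<noteq> f y"
    "e = {f x, f y}"
    using assms(2) by (simp_all add: inj_on_eq_iff)
  then show "\<exists>x\<in>verts (image_graph f G). \<exists>y\<in>verts (image_graph f G). x \<noteq> y \<and> e = {x, y}"
    by blast
qed

lemma super_image:
  assumes "G \<in> super \<U>" "inj_on f (verts G)"
  shows "image_graph f G \<in> super \<U>"
proof -
  obtain F S g where F: "F \<in> \<U>" and S: "subgraph S G" and g: "graph_iso g F S"
    and G: "simple_graph G"
    using assms(1) by (auto simp: super_def isomorphic_def)
  have inj: "inj_on f (verts S)"
    using assms(2) S by (auto simp: subgraph_def intro: inj_on_subset)
  have "subgraph (image_graph f S) (image_graph f G)"
    using S inj by (auto simp: subgraph_def intro!: simple_graph_image)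
  moreover have "graph_iso (f \<circ> g) F (image_graph f S)"
    using g inj unfolding graph_iso_def
    by (metis bij_betw_trans image_graph_comp inj_on_imp_bij_betw verts_image_graph)
  ultimately show ?thesis
    using F G assms(2) by (auto simp: super_def isomorphic_def intro: simple_graph_image)
qed

lemma image_graph_inverse:
  assumes "simple_graph G" "inj_on f (verts G)"
  shows "image_graph (the_inv_into (verts G) f) (image_graph f G) = G"
proof -
  have "image_graph (the_inv_into (verts G) f) (image_graph f G) = image_graph id G"
    unfolding image_graph_comp
    by (rule image_graph_cong)
       (use assms edge_subset_verts in \<open>auto simp: the_inv_into_f_f\<close>)
  then show ?thesis by simp
qed

text \<open>Membership in \<open>\<G>\<close> transfers because graph classes are closed under
  isomorphism. If the image contained a copy of a member of \<open>\<U>\<close>, the inverse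
  renaming would carry that copy back into \<open>G\<close>.\<close>

lemma class_image:
  assumes "graph_class \<G>" "G \<in> \<G> - super \<U>" "inj_on f (verts G)"
  shows "image_graph f G \<in> \<G> - super \<U>"
proof -
  have "simple_graph G" using assms by (auto simp: graph_class_def)
  moreover have "isomorphic G (image_graph f G)"
    using assms(3) by (auto simp: isomorphic_def graph_iso_def intro!: inj_on_imp_bij_betw)
  moreover have "inj_on (the_inv_into (verts G) f) (verts (image_graph f G))"
    using assms(3) by (simp add: inj_on_the_inv_into)
  ultimately show ?thesis
    using assms super_image[of "image_graph f G" \<U> "the_inv_into (verts G) f"]
    by (auto simp: graph_class_def image_graph_inverse)
qed

lemma super_mono:
  assumes "H \<in> super \<U>" "simple_graph G" "verts H \<subseteq> verts G" "edges H \<subseteq> edges G"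
  shows "G \<in> super \<U>"
proof -
  have "subgraph S G" if "subgraph S H" for S
    using that assms by (auto simp: subgraph_def)
  then show ?thesis using assms(1,2) by (auto simp: super_def)
qed

text \<open>A renaming is often given only on the vertices of a pair, while it has to act on a whole
  graph containing the pair. In an infinite type the other vertices can be sent to fresh
  places.\<close>

lemma inj_on_extend:
  fixes f :: "'a \<Rightarrow> 'a"
  assumes "finite V" "S \<subseteq> V" "inj_on f S" "infinite (UNIV :: 'a set)"
  obtains g where "inj_on g V" "\<And>x. x \<in> S \<Longrightarrow> g x = f x"
proof -
  have "finite S" using assms finite_subset by blast
  then have "infinite (- (f ` S))" using assms(4) by (simp add: Compl_eq_Diff_UNIV)
  then obtain T where T: "T \<subseteq> - (f ` S)" "finite T" "card T = card (V - S)"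
    by (metis infinite_arbitrarily_large)
  then obtain h where h: "bij_betw h (V - S) T"
    using assms(1) finite_same_card_bij by (metis finite_Diff)
  define g where "g x = (if x \<in> S then f x else h x)" for x
  have "inj_on g (S \<union> (V - S))"
  proof (subst inj_on_Un, intro conjI)
    show "inj_on g S" using assms(3) by (simp add: g_def inj_on_def)
    show "inj_on g (V - S)" using h by (auto simp: g_def inj_on_def bij_betw_def)
    have "g ` S = f ` S" "g ` (V - S) = T"
      using h by (auto simp: g_def bij_betw_def)
    then show "g ` (S - (V - S)) \<inter> g ` ((V - S) - S) = {}"
      using T(1) by (auto simp: Diff_triv)
  qed
  then have "inj_on g V" using assms(2) by (simp add: Un_absorb1)
  with that show thesis by (simp add: g_def)
qed

section \<open>Completable bags\<close>

text \<open>With \<open>S\<close> the set of vertices seen so far, this says that no edge from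
  \<open>z\<close> to a later vertex remains, so that \<open>z\<close> may leave the bag.\<close>

definition closed_in :: "'a graph \<Rightarrow> 'a set \<Rightarrow> 'a \<Rightarrow> bool" where
  "closed_in G S z \<longleftrightarrow> (\<forall>e\<in>edges G. z \<in> e \<longrightarrow> e \<subseteq> S)"

text \<open>
  \<open>B\<close> is the current bag and \<open>D\<close> the set of vertices that have already left the bags. Bags may
  have fewer than \<open>n\<close> elements, which makes the exchange arguments below simple inductions.
\<close>

inductive completable :: "nat \<Rightarrow> 'a graph \<Rightarrow> 'a set \<Rightarrow> 'a set \<Rightarrow> bool" for n G where
  complete: "verts G \<subseteq> B \<union> D \<Longrightarrow> completable n G B D"
| forget: "z \<in> B \<Longrightarrow> closed_in G (B \<union> D) z \<Longrightarrow> completable n G (B - {z}) (insert z D) \<Longrightarrow>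
    completable n G B D"
| introduce: "x \<in> verts G - (B \<union> D) \<Longrightarrow> card B < n \<Longrightarrow> completable n G (insert x B) D \<Longrightarrow>
    completable n G B D"

text \<open>If the completion forgets \<open>y\<close> at some later point, this step is simply
  moved to the front. The bags in between lose \<open>y\<close>, and \<open>B \<union> D\<close> is
  unchanged, so all other steps stay legal.\<close>

lemma completable_forget_closed:
  assumes "completable n G B D" "y \<in> B" "closed_in G (B \<union> D) y"
  shows "completable n G (B - {y}) (insert y D)"
  using assms
proof induction
  case (complete B D)
  then show ?case by - (rule completable.complete, auto)
next
  case (forget z B D)
  show ?case
  proof (cases "z = y")
    case False
    have eq: "B - {z} \<union> insert z D = B \<union> D" "B - {y} \<union> insert y D = B \<union> D"
      using forget.hyps forget.prems by auto
    have "completable n G (B - {z} - {y}) (insert y (insert z D))"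
      using forget False eq by - (rule forget.IH, auto)
    moreover have "B - {z} - {y} = B - {y} - {z}" "insert y (insert z D) = insert z (insert y D)"
      by auto
    ultimately have "completable n G (B - {y} - {z}) (insert z (insert y D))" by simp
    moreover have "z \<in> B - {y}" using forget.hyps False by simp
    moreover have "closed_in G (B - {y} \<union> insert y D) z" using forget.hyps eq by simp
    ultimately show ?thesis by - (rule completable.forget[of z])
  qed (use forget in auto)
next
  case (introduce x B D)
  then have "x \<noteq> y" by auto
  have "completable n G (insert x B - {y}) (insert y D)"
    using introduce by - (rule introduce.IH, auto simp: closed_in_def)
  moreover have "insert x B - {y} = insert x (B - {y})" using \<open>x \<noteq> y\<close> by auto
  moreover have "card (B - {y}) < n"
    using introduce.hyps card_Diff1_le[of B y] by linarith
  ultimately show ?case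
    using introduce \<open>x \<noteq> y\<close> by - (rule completable.introduce[of x], auto)
qed

text \<open>The first introduction of the completion is moved before the forget steps that precede
  it. Those steps stay legal because \<open>B \<union> D\<close> only grows. This is how bags are
  refilled to full size for a smooth decomposition.\<close>

lemma completable_introduce_some:
  assumes "completable n G B D" "card B < n" "\<not> verts G \<subseteq> B \<union> D"
  shows "\<exists>x\<in>verts G - (B \<union> D). completable n G (insert x B) D"
  using assms
proof induction
  case (forget z B D)
  have eq: "B - {z} \<union> insert z D = B \<union> D" using forget.hyps by auto
  have "card (B - {z}) < n" using forget.prems card_Diff1_le[of B z] by linarith
  then obtain x where x: "x \<in> verts G - (B \<union> D)"
      "completable n G (insert x (B - {z})) (insert z D)"
    using forget eq by metis
  then have "insert x (B - {z}) = insert x B - {z}" using forget.hyps by auto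
  then have "completable n G (insert x B - {z}) (insert z D)" using x by simp
  moreover have "closed_in G (insert x B \<union> D) z"
    using forget.hyps unfolding closed_in_def by blast
  ultimately have "completable n G (insert x B) D"
    using forget.hyps by - (rule completable.forget[of z], auto)
  then show ?case using x by auto
qed auto

text \<open>As long as \<open>w\<close> is missing, \<open>y\<close> has to stay in the bag. So
  \<open>w\<close> can occupy the place of \<open>y\<close> until the original completion introduces
  \<open>w\<close>; from then on \<open>y\<close> is closed and
  \<open>completable_forget_closed\<close> applies.\<close>

lemma completable_replace_by_neighbour:
  assumes "completable n G B D" "y \<in> B" "{y, w} \<in> edges G" "w \<in> verts G - (B \<union> D)"
    "closed_in G (insert w (B \<union> D)) y"
  shows "completable n G (insert w (B - {y})) (insert y D)"
  using assms
proof induction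
  case (complete B D)
  then show ?case by auto
next
  case (forget z B D)
  have "z \<noteq> y" using forget by (auto simp: closed_in_def)
  then have eq: "B - {z} \<union> insert z D = B \<union> D" using forget by auto
  have "completable n G (insert w (B - {z} - {y})) (insert y (insert z D))"
    by (rule forget.IH) (use forget.prems \<open>z \<noteq> y\<close> eq in auto)
  moreover have "insert w (B - {z} - {y}) = insert w (B - {y}) - {z}"
    "insert y (insert z D) = insert z (insert y D)"
    using forget.hyps forget.prems by auto
  moreover have "closed_in G (insert w (B - {y}) \<union> insert y D) z"
    using forget.hyps unfolding closed_in_def by blast
  ultimately show ?case
    using forget.hyps \<open>z \<noteq> y\<close> by - (rule completable.forget[of z], auto)
next
  case (introduce x B D)
  show ?case
  proof (cases "x = w")
    case True
    have "completable n G (insert w B - {y}) (insert y D)"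
      using introduce True by (intro completable_forget_closed) auto
    moreover have "insert w B - {y} = insert w (B - {y})" using introduce by auto
    ultimately show ?thesis by simp
  next
    case False
    have "x \<noteq> y" using introduce by auto
    have "completable n G (insert w (insert x B - {y})) (insert y D)"
      using introduce False by - (rule introduce.IH, auto simp: closed_in_def)
    moreover have "insert w (insert x B - {y}) = insert x (insert w (B - {y}))"
      using \<open>x \<noteq> y\<close> by auto
    moreover have "card (insert w (B - {y})) < n"
    proof (cases "finite B")
      case True
      then have "card (insert w (B - {y})) \<le> Suc (card (B - {y}))" by (simp add: card_insert_if)
      also have "\<dots> = card B" using True introduce.prems by (intro card_Suc_Diff1) auto
      finally show ?thesis using introduce.hyps by simp
    qed (use introduce.hyps in simp)
    ultimately show ?thesis
      using introduce False \<open>x \<noteq> y\<close> by - (rule completable.introduce[of x], auto)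
  qed
qed

lemma completable_forget_set:
  assumes "finite Z" "Z \<subseteq> B" "\<And>z. z \<in> Z \<Longrightarrow> closed_in G (B \<union> D) z"
    "completable n G (B - Z) (Z \<union> D)"
  shows "completable n G B D"
  using assms
proof (induction Z arbitrary: B D)
  case (insert z Z)
  have "completable n G (B - {z}) (insert z D)"
  proof (rule insert.IH)
    have "B - {z} - Z = B - insert z Z" "Z \<union> insert z D = insert z Z \<union> D" by auto
    then show "completable n G (B - {z} - Z) (Z \<union> insert z D)" using insert.prems by simp
    have "B - {z} \<union> insert z D = B \<union> D" using insert.prems by auto
    then show "closed_in G (B - {z} \<union> insert z D) a" if "a \<in> Z" for a
      using insert.prems that by auto
  qed (use insert in auto)
  then show ?case using insert.prems by - (rule completable.forget[of z], auto)
qed simp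

lemma completable_introduce_set:
  assumes "finite X" "finite B" "X \<subseteq> verts G - (B \<union> D)" "card (B \<union> X) \<le> n"
    "completable n G (B \<union> X) D"
  shows "completable n G B D"
  using assms
proof (induction X arbitrary: B)
  case (insert x X)
  have eq: "insert x B \<union> X = B \<union> insert x X" by auto
  have "completable n G (insert x B) D"
    using insert eq by - (rule insert.IH, auto)
  moreover have "card (insert x B) \<le> card (B \<union> insert x X)"
    using insert by (intro card_mono) auto
  ultimately show ?case
    using insert by - (rule completable.introduce[of x], auto)
qed simp

section \<open>Path-decompositions\<close>

text \<open>The interval condition as a property of the list alone, which suits inductions that
  append bags. For bags consisting of vertices of \<open>G\<close> it agrees with the clause in
  \<open>path_decomposition\<close>.\<close>

definition interval_bags :: "'a set list \<Rightarrow> bool" where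
  "interval_bags Vs \<longleftrightarrow> (\<forall>x i j l. i \<le> j \<and> j \<le> l \<and> l < length Vs \<and> x \<in> Vs ! i \<and> x \<in> Vs ! l
     \<longrightarrow> x \<in> Vs ! j)"

lemma path_decomposition_iff:
  "path_decomposition G Vs \<longleftrightarrow> \<Union> (set Vs) = verts G \<and>
     (\<forall>e\<in>edges G. \<exists>B\<in>set Vs. e \<subseteq> B) \<and> interval_bags Vs"
proof
  assume "path_decomposition G Vs"
  note pd = this[unfolded path_decomposition_def]
  have sub: "\<forall>B\<in>set Vs. B \<subseteq> verts G" and cov: "\<forall>x\<in>verts G. \<exists>B\<in>set Vs. x \<in> B"
    and edg: "\<forall>e\<in>edges G. \<exists>B\<in>set Vs. e \<subseteq> B"
    by (rule pd[THEN conjunct1] pd[THEN conjunct2, THEN conjunct1]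
        pd[THEN conjunct2, THEN conjunct2, THEN conjunct1])+
  note int = pd[THEN conjunct2, THEN conjunct2, THEN conjunct2]
  have "interval_bags Vs"
    unfolding interval_bags_def
  proof (intro allI impI, elim conjE)
    fix x i j l
    assume h: "i \<le> j" "j \<le> l" "l < length Vs" "x \<in> Vs ! i" "x \<in> Vs ! l"
    then have "Vs ! l \<in> set Vs" by simp
    then have "x \<in> verts G" using sub h(5) by blast
    from int[THEN bspec, OF this, THEN spec[of _ i], THEN spec[of _ j], THEN spec[of _ l]]
    show "x \<in> Vs ! j" using h by simp
  qed
  moreover have "\<Union> (set Vs) = verts G" using sub cov by blast
  ultimately show "\<Union> (set Vs) = verts G \<and> (\<forall>e\<in>edges G. \<exists>B\<in>set Vs. e \<subseteq> B) \<and> interval_bags Vs"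
    using edg by simp
next
  assume h: "\<Union> (set Vs) = verts G \<and> (\<forall>e\<in>edges G. \<exists>B\<in>set Vs. e \<subseteq> B) \<and> interval_bags Vs"
  then have edg: "\<forall>e\<in>edges G. \<exists>B\<in>set Vs. e \<subseteq> B" and int: "interval_bags Vs"
    and sub: "\<forall>B\<in>set Vs. B \<subseteq> verts G" and cov: "\<forall>x\<in>verts G. \<exists>B\<in>set Vs. x \<in> B"
    by blast+
  note int' = int[unfolded interval_bags_def, THEN spec]
  show "path_decomposition G Vs"
    unfolding path_decomposition_def by (rule conjI sub cov edg ballI int')+
qed

text \<open>A vertex of \<open>B\<close> that occurred before still lies in the last bag, so no gap
  arises.\<close>

lemma interval_bags_append:
  assumes "interval_bags Vs" "Vs \<noteq> []" "B \<inter> \<Union> (set Vs) \<subseteq> last Vs"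
  shows "interval_bags (Vs @ [B])"
  unfolding interval_bags_def
proof (intro allI impI, elim conjE)
  fix x i j l
  assume h: "i \<le> j" "j \<le> l" "l < length (Vs @ [B])" "x \<in> (Vs @ [B]) ! i" "x \<in> (Vs @ [B]) ! l"
  show "x \<in> (Vs @ [B]) ! j"
  proof (cases "l < length Vs")
    case True
    then have "x \<in> Vs ! i" "x \<in> Vs ! l" using h by (auto simp: nth_append)
    then have "x \<in> Vs ! j" using h True assms(1) unfolding interval_bags_def by blast
    then show ?thesis using h True by (simp add: nth_append)
  next
    case l: False
    show ?thesis
    proof (cases "i < length Vs \<and> j < length Vs")
    case True
    then have *: "j < length Vs" "i < length Vs" "l = length Vs" using h l by auto
    then have "x \<in> Vs ! i" "x \<in> B" using h by (auto simp: nth_append)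
    moreover from this have "x \<in> last Vs" using assms(3) * nth_mem by blast
    then have "x \<in> Vs ! (length Vs - 1)" using assms(2) by (simp add: last_conv_nth)
    moreover have "j \<le> length Vs - 1" "length Vs - 1 < length Vs" using * by auto
    ultimately have "x \<in> Vs ! j" using assms(1) h(1) unfolding interval_bags_def by blast
    then show ?thesis using * by (simp add: nth_append)
    next
      case False
      then have "j = l" using h l by auto
      then show ?thesis using h by simp
    qed
  qed
qed

text \<open>The truncated subtraction in \<open>width\<close> does no harm to upper bounds;
  non-emptiness of the list gives \<open>Max\<close> its meaning.\<close>

lemma width_le_iff: "Vs \<noteq> [] \<Longrightarrow> width Vs \<le> k \<longleftrightarrow> (\<forall>B\<in>set Vs. card B \<le> k + 1)"
proof -
  assume "Vs \<noteq> []"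
  then have "width Vs \<le> k \<longleftrightarrow> Max (card ` set Vs) \<le> k + 1"
    by (simp only: width_def le_diff_conv)
  also have "\<dots> \<longleftrightarrow> (\<forall>B\<in>set Vs. card B \<le> k + 1)"
    using \<open>Vs \<noteq> []\<close> by (subst Max_le_iff) auto
  finally show ?thesis .
qed

lemma path_width_le:
  assumes "path_decomposition G Vs" "width Vs \<le> k"
  shows "path_width G \<le> k"
  unfolding path_width_def by (rule order_trans[OF Least_le assms(2)]) (use assms(1) in auto)

lemma path_width_decomposition:
  assumes "simple_graph G"
  obtains Vs where "path_decomposition G Vs" "width Vs = path_width G" "Vs \<noteq> []"
proof -
  \<comment> \<open>The trivial decomposition shows that some width occurs, so the
    \<open>LEAST\<close> in \<open>path_width\<close> is attained.\<close>
  have "path_decomposition G [verts G]"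
    using edge_subset_verts[OF assms]
    by (auto simp: path_decomposition_iff interval_bags_def)
  then have "\<exists>w Vs. path_decomposition G Vs \<and> width Vs = w" by blast
  from LeastI_ex[OF this] obtain Vs where Vs: "path_decomposition G Vs" "width Vs = path_width G"
    unfolding path_width_def by blast
  moreover have "Vs \<noteq> []"
    using Vs(1) assms by (auto simp: path_decomposition_iff simple_graph_def)
  ultimately show thesis using that by blast
qed

text \<open>At the cut between \<open>As\<close> and \<open>Bs\<close>, the vertices on both sides
  form the current bag and those only on the left are finished. Passing a bag \<open>B\<close> means
  introducing its new vertices and then forgetting those that occur in no later bag.\<close>

lemma completable_suffix:
  assumes "finite (verts G)" "path_decomposition G (As @ Bs)" "\<forall>B\<in>set (As @ Bs). card B \<le> n"
  shows "completable n G (\<Union> (set As) \<inter> \<Union> (set Bs)) (\<Union> (set As) - \<Union> (set Bs))"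
  using assms(2,3)
proof (induction Bs arbitrary: As)
  case Nil
  then show ?case by - (rule completable.complete, auto simp: path_decomposition_iff)
next
  case (Cons B Bs)
  let ?A = "\<Union> (set As)" and ?C = "\<Union> (set Bs)"
  have pd: "\<Union> (set (As @ B # Bs)) = verts G" "interval_bags (As @ B # Bs)"
    "\<forall>e\<in>edges G. \<exists>B'\<in>set (As @ B # Bs). e \<subseteq> B'"
    using Cons.prems by (simp_all add: path_decomposition_iff)
  then have fin: "finite B" "finite ?A" using assms(1) by (auto intro: finite_subset)
  \<comment> \<open>Interval condition: a vertex occurring both before and after \<open>B\<close>
    lies in \<open>B\<close>.\<close>
  have AC: "?A \<inter> ?C \<subseteq> B"
  proof
    fix x assume "x \<in> ?A \<inter> ?C"
    then obtain i l where il: "i < length As" "x \<in> As ! i" "l < length Bs" "x \<in> Bs ! l"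
      by (auto simp: in_set_conv_nth)
    have "(As @ B # Bs) ! (Suc (length As + l)) = Bs ! l"
      by (simp add: nth_append)
    moreover have "(As @ B # Bs) ! i = As ! i" "(As @ B # Bs) ! length As = B"
      using il by (auto simp: nth_append)
    moreover have "i \<le> length As" "length As \<le> Suc (length As + l)"
      "Suc (length As + l) < length (As @ B # Bs)" using il by auto
    ultimately show "x \<in> B"
      using pd(2) il unfolding interval_bags_def by metis
  qed
  have "completable n G (\<Union> (set (As @ [B])) \<inter> ?C) (\<Union> (set (As @ [B])) - ?C)"
    using Cons.prems by - (rule Cons.IH, auto)
  moreover have "\<Union> (set (As @ [B])) \<inter> ?C = B - (B - ?C)"
    "\<Union> (set (As @ [B])) - ?C = (B - ?C) \<union> (?A - B)"
    using AC by auto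
  ultimately have "completable n G (B - (B - ?C)) ((B - ?C) \<union> (?A - B))" by simp
  then have "completable n G B (?A - B)"
  proof (rule completable_forget_set[rotated 3])
    fix z assume z: "z \<in> B - ?C"
    \<comment> \<open>Each edge at \<open>z\<close> lies in a bag with \<open>z\<close>, and
      \<open>z\<close> is in no bag after \<open>B\<close>, so that bag is \<open>B\<close> or an
      earlier one.\<close>
    show "closed_in G (B \<union> (?A - B)) z"
      unfolding closed_in_def
    proof (intro ballI impI)
      fix e assume "e \<in> edges G" "z \<in> e"
      moreover from this obtain B' where "B' \<in> set (As @ B # Bs)" "e \<subseteq> B'" using pd(3) by blast
      ultimately show "e \<subseteq> B \<union> (?A - B)" using z by auto
    qed
  qed (use fin in auto)
  moreover have "(?A \<inter> B) \<union> (B - ?A) = B" by auto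
  ultimately have "completable n G (?A \<inter> B) (?A - B)"
    using fin Cons.prems(2) pd(1)
    by - (rule completable_introduce_set[of "B - ?A"], auto)
  moreover have "?A \<inter> \<Union> (set (B # Bs)) = ?A \<inter> B" "?A - \<Union> (set (B # Bs)) = ?A - B"
    using AC by auto
  ultimately show ?case by simp
qed

text \<open>Starting with the empty bag, vertices are added one by one with
  \<open>completable_introduce_some\<close>. The lower bound on the order of \<open>G\<close>
  ensures that one is available until the bag is full.\<close>

lemma completable_initial:
  assumes "simple_graph G" "path_width G \<le> k" "k + 1 \<le> card (verts G)"
  shows "\<exists>U\<subseteq>verts G. card U = k + 1 \<and> completable (k + 1) G U {}"
proof -
  obtain Vs where Vs: "path_decomposition G Vs" "width Vs \<le> k" "Vs \<noteq> []"
    using path_width_decomposition[OF assms(1)] assms(2) by metis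
  have fin: "finite (verts G)" using assms(1) by (simp add: simple_graph_def)
  have start: "completable (k + 1) G {} {}"
    using completable_suffix[OF fin, of "[]" Vs "k + 1"] Vs width_le_iff by auto
  have "\<exists>U\<subseteq>verts G. card U = m \<and> completable (k + 1) G U {}" if "m \<le> k + 1" for m
    using that
  proof (induction m)
    case 0
    then show ?case using start by (intro exI[of _ "{}"]) auto
  next
    case (Suc m)
    then obtain U where U: "U \<subseteq> verts G" "card U = m" "completable (k + 1) G U {}" by auto
    have "\<not> verts G \<subseteq> U"
      using U Suc.prems assms(3) by (metis Suc_le_eq subset_antisym leD order_trans)
    then obtain x where "x \<in> verts G - U" "completable (k + 1) G (insert x U) {}"
      using completable_introduce_some[of "k + 1" G U "{}"] U Suc.prems by auto
    then show ?case
      using U finite_subset[OF U(1) fin] by (intro exI[of _ "insert x U"]) auto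
  qed
  then show ?thesis by blast
qed

section \<open>Initial parts of smooth path-decompositions\<close>

text \<open>Replacing exactly one vertex keeps the bag size constant and makes consecutive bags
  share \<open>k\<close> vertices. That the replaced vertex is closed ensures that every edge among
  the seen vertices lies in a bag.\<close>

inductive smooth_prefix :: "nat \<Rightarrow> 'a graph \<Rightarrow> 'a set list \<Rightarrow> bool" for k G where
  single: "U \<subseteq> verts G \<Longrightarrow> card U = k + 1 \<Longrightarrow> smooth_prefix k G [U]"
| snoc: "smooth_prefix k G Vs \<Longrightarrow> z \<in> last Vs \<Longrightarrow> closed_in G (\<Union> (set Vs)) z \<Longrightarrow>
    x \<in> verts G - \<Union> (set Vs) \<Longrightarrow> smooth_prefix k G (Vs @ [insert x (last Vs - {z})])"

lemma smooth_prefix_nonempty: "smooth_prefix k G Vs \<Longrightarrow> Vs \<noteq> []"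
  by (induction rule: smooth_prefix.induct) auto

lemma smooth_prefix_last_in_set: "smooth_prefix k G Vs \<Longrightarrow> last Vs \<in> set Vs"
  using smooth_prefix_nonempty last_in_set by blast

lemma smooth_prefix_last: "smooth_prefix k G Vs \<Longrightarrow> last Vs \<subseteq> \<Union> (set Vs)"
  using smooth_prefix_last_in_set by blast

lemma smooth_prefix_verts: "smooth_prefix k G Vs \<Longrightarrow> \<Union> (set Vs) \<subseteq> verts G"
proof (induction rule: smooth_prefix.induct)
  case (snoc Vs z x)
  then have "last Vs \<subseteq> verts G" using smooth_prefix_last[OF snoc.hyps(1)] by blast
  then show ?case using snoc by auto
qed auto

lemma smooth_prefix_card: "smooth_prefix k G Vs \<Longrightarrow> B \<in> set Vs \<Longrightarrow> card B = k + 1"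
proof (induction arbitrary: B rule: smooth_prefix.induct)
  case (snoc Vs z x)
  have "last Vs \<in> set Vs" using snoc.hyps(1) by (rule smooth_prefix_last_in_set)
  with snoc have "card (last Vs) = k + 1" "x \<notin> last Vs" by auto
  moreover from this have "finite (last Vs)" using card.infinite by fastforce
  ultimately have "card (insert x (last Vs - {z})) = k + 1" using snoc by simp
  then show ?case using snoc by auto
qed auto

text \<open>A vertex is closed at the moment it leaves the bag, and it stays closed when further
  vertices appear.\<close>

lemma smooth_prefix_closed:
  "smooth_prefix k G Vs \<Longrightarrow> d \<in> \<Union> (set Vs) - last Vs \<Longrightarrow> closed_in G (\<Union> (set Vs)) d"
proof (induction rule: smooth_prefix.induct)
  case (snoc Vs z x)
  then have "d \<in> \<Union> (set Vs) - (last Vs - {z})" by auto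
  then have "closed_in G (\<Union> (set Vs)) d" using snoc by (cases "d = z") auto
  then show ?case by (auto simp: closed_in_def)
qed auto

lemma smooth_prefix_interval: "smooth_prefix k G Vs \<Longrightarrow> interval_bags Vs"
proof (induction rule: smooth_prefix.induct)
  case (single U)
  then show ?case by (auto simp: interval_bags_def)
next
  case (snoc Vs z x)
  then show ?case
    using smooth_prefix_nonempty by (intro interval_bags_append) auto
qed

text \<open>If the edge contains the new vertex \<open>x\<close>, then none of its old ends is
  closed with respect to the earlier vertices. So they have not left the bag, and the edge lies in
  the new bag.\<close>

lemma smooth_prefix_edges:
  "smooth_prefix k G Vs \<Longrightarrow> e \<in> edges G \<Longrightarrow> e \<subseteq> \<Union> (set Vs) \<Longrightarrow> \<exists>B\<in>set Vs. e \<subseteq> B"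
proof (induction rule: smooth_prefix.induct)
  case (snoc Vs z x)
  show ?case
  proof (cases "x \<in> e")
    case True
    have "y \<in> insert x (last Vs - {z})" if "y \<in> e" for y
    proof (rule ccontr)
      assume y: "y \<notin> insert x (last Vs - {z})"
      then have "y \<in> \<Union> (set Vs)" using that snoc.prems by auto
      then have "closed_in G (\<Union> (set Vs)) y"
        using y snoc.hyps smooth_prefix_closed[OF snoc.hyps(1), of y] by (cases "y = z") auto
      then show False using that True snoc.prems snoc.hyps unfolding closed_in_def by blast
    qed
    then show ?thesis by auto
  next
    case False
    have "\<Union> (set (Vs @ [insert x (last Vs - {z})])) \<subseteq> insert x (\<Union> (set Vs))"
      using smooth_prefix_last[OF snoc.hyps(1)] by auto
    then have "e \<subseteq> \<Union> (set Vs)" using snoc.prems False by blast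
    then show ?thesis using snoc.IH snoc.prems by auto
  qed
qed auto

lemma smooth_prefix_consecutive:
  "smooth_prefix k G Vs \<Longrightarrow> Suc i < length Vs \<Longrightarrow> card (Vs ! i \<inter> Vs ! Suc i) = k"
proof (induction arbitrary: i rule: smooth_prefix.induct)
  case (snoc Vs z x)
  show ?case
  proof (cases "Suc i < length Vs")
    case True
    then show ?thesis using snoc by (simp add: nth_append)
  next
    case False
    then have i: "i = length Vs - 1" "Suc i = length Vs"
      using snoc.prems smooth_prefix_nonempty[OF snoc.hyps(1)] by auto
    have last: "last Vs \<in> set Vs" "Vs ! i = last Vs"
      using smooth_prefix_nonempty[OF snoc.hyps(1)] by (auto simp: i last_conv_nth)
    then have "card (last Vs) = k + 1" using smooth_prefix_card snoc.hyps(1) by blast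
    then have "card (last Vs - {z}) = k" using snoc.hyps(2) by simp
    moreover have "last Vs \<inter> insert x (last Vs - {z}) = last Vs - {z}"
      using snoc.hyps last by auto
    ultimately show ?thesis using i last by (simp add: nth_append)
  qed
qed auto

text \<open>While vertices are missing and the bag is full, a completion can only begin with a
  forget step. That makes room for an introduction, and the two together are one smooth step; the
  number of missing vertices decreases.\<close>

lemma smooth_prefix_extend:
  assumes "finite (verts G)" "smooth_prefix k G Vs"
    "completable (k + 1) G (last Vs) (\<Union> (set Vs) - last Vs)"
  shows "\<exists>Ws. smooth_prefix k G (Vs @ Ws) \<and> \<Union> (set (Vs @ Ws)) = verts G"
  using assms(2,3)
proof (induction "card (verts G - \<Union> (set Vs))" arbitrary: Vs rule: less_induct)
  case less
  have eq: "last Vs \<union> (\<Union> (set Vs) - last Vs) = \<Union> (set Vs)"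
    using smooth_prefix_last[OF less.prems(1)] by auto
  have card: "card (last Vs) = k + 1"
    using smooth_prefix_card[OF less.prems(1)] smooth_prefix_nonempty[OF less.prems(1)] by simp
  show ?case
  proof (cases "verts G \<subseteq> \<Union> (set Vs)")
    case True
    then show ?thesis
      using less.prems(1) smooth_prefix_verts[OF less.prems(1)] by (intro exI[of _ "[]"]) auto
  next
    case False
    from less.prems(2) obtain z where z: "z \<in> last Vs" "closed_in G (\<Union> (set Vs)) z"
        "completable (k + 1) G (last Vs - {z}) (insert z (\<Union> (set Vs) - last Vs))"
      by cases (use eq card False in auto)
    have eq2: "last Vs - {z} \<union> insert z (\<Union> (set Vs) - last Vs) = \<Union> (set Vs)"
      using eq z by auto
    have "card (last Vs - {z}) < k + 1" using card z by simp
    then obtain x where x: "x \<in> verts G - \<Union> (set Vs)"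
      "completable (k + 1) G (insert x (last Vs - {z})) (insert z (\<Union> (set Vs) - last Vs))"
      using completable_introduce_some[OF z(3)] eq2 False by metis
    let ?Vs = "Vs @ [insert x (last Vs - {z})]"
    have "smooth_prefix k G ?Vs" using less.prems z x by (intro smooth_prefix.snoc) auto
    moreover have "\<Union> (set ?Vs) - last ?Vs = insert z (\<Union> (set Vs) - last Vs)"
      using eq z x by auto
    moreover have "card (verts G - \<Union> (set ?Vs)) < card (verts G - \<Union> (set Vs))"
      using x assms(1) by (intro psubset_card_mono) auto
    ultimately have "\<exists>Ws. smooth_prefix k G (?Vs @ Ws) \<and> \<Union> (set (?Vs @ Ws)) = verts G"
      using x by (intro less.hyps) auto
    then show ?thesis by (metis append.assoc)
  qed
qed

lemma smooth_prefix_decomposition: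
  assumes "simple_graph G" "smooth_prefix k G Vs" "\<Union> (set Vs) = verts G"
  shows "smooth_path_decomposition k G Vs"
proof -
  have "card ` set Vs = {k + 1}"
    using smooth_prefix_card[OF assms(2)] smooth_prefix_nonempty[OF assms(2)]
    by (auto simp: image_def neq_Nil_conv)
  then have "width Vs = k" by (simp add: width_def)
  then show ?thesis
    using assms smooth_prefix_interval smooth_prefix_edges smooth_prefix_card
      smooth_prefix_consecutive edge_subset_verts
    unfolding smooth_path_decomposition_def path_decomposition_iff by metis
qed

text \<open>The associated graph of the last bag, expressed by the prefix only. By
  \<open>associated_graph_append\<close> it does not depend on how the prefix is continued.\<close>

definition partial_graph :: "'a graph \<Rightarrow> 'a set list \<Rightarrow> 'a graph" where
  "partial_graph G Vs = Graph (\<Union> (set Vs)) {e \<in> edges G. e \<subseteq> \<Union> (set Vs) \<and> \<not> e \<subseteq> last Vs}"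

lemma verts_partial_graph [simp]: "verts (partial_graph G Vs) = \<Union> (set Vs)"
  and edges_partial_graph [simp]:
    "edges (partial_graph G Vs) = {e \<in> edges G. e \<subseteq> \<Union> (set Vs) \<and> \<not> e \<subseteq> last Vs}"
  by (simp_all add: partial_graph_def)

lemma associated_graph_append:
  assumes "Vs \<noteq> []" "\<Union> (set Vs) \<subseteq> verts G"
  shows "associated_graph G (Vs @ Ws) (length Vs - 1) = partial_graph G Vs"
proof -
  have "(\<Union>j\<le>length Vs - 1. (Vs @ Ws) ! j) = (\<Union>j<length Vs. Vs ! j)"
  proof (rule SUP_cong)
    show "{..length Vs - 1} = {..<length Vs}" using assms(1) by (cases Vs) auto
  qed (simp add: nth_append)
  also have "\<dots> = \<Union> (set Vs)" by (auto simp: set_conv_nth)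
  finally have 1: "(\<Union>j\<le>length Vs - 1. (Vs @ Ws) ! j) = \<Union> (set Vs)" .
  have 2: "(Vs @ Ws) ! (length Vs - 1) = last Vs"
    using assms(1) by (simp add: nth_append last_conv_nth)
  show ?thesis
    unfolding associated_graph_def 1 2 using assms(2)
    by (intro graph_eqI) (auto simp: del_edges_def induced_subgraph_def)
qed

lemma smooth_prefix_contains_pair:
  assumes "simple_graph G" "smooth_prefix k G Vs"
    "completable (k + 1) G (last Vs) (\<Union> (set Vs) - last Vs)"
  shows "contains_pair k G (last Vs, partial_graph G Vs)"
proof -
  have "finite (verts G)" using assms(1) by (simp add: simple_graph_def)
  then obtain Ws where "smooth_path_decomposition k G (Vs @ Ws)"
    using smooth_prefix_extend smooth_prefix_decomposition assms by metis
  moreover have ne: "Vs \<noteq> []" using assms(2) smooth_prefix_nonempty by blast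
  moreover have "(Vs @ Ws) ! (length Vs - 1) = last Vs"
    using ne by (simp add: nth_append last_conv_nth)
  moreover have "length Vs - 1 < length (Vs @ Ws)" using ne by (cases Vs) auto
  ultimately show ?thesis
    unfolding contains_pair_def
    using associated_graph_append[OF ne smooth_prefix_verts[OF assms(2)], of Ws]
    by (intro exI[of _ "Vs @ Ws"] exI[of _ "length Vs - 1"]) auto
qed

text \<open>An edge that is not contained in the new bag has an end that is closed in the old
  vertices, so it cannot contain \<open>x\<close>. Hence \<open>x\<close> is isolated and the edge
  set does not depend on its choice, which is the basis of the exchange in
  \<open>removable_degree_two\<close>.\<close>

lemma partial_graph_snoc:
  assumes "smooth_prefix k G Vs" "closed_in G (\<Union> (set Vs)) z" "x \<notin> \<Union> (set Vs)"
  shows "partial_graph G (Vs @ [insert x (last Vs - {z})]) =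
    Graph (insert x (\<Union> (set Vs))) {e \<in> edges G. e \<subseteq> \<Union> (set Vs) \<and> \<not> e \<subseteq> last Vs - {z}}"
proof (rule graph_eqI)
  have "e \<subseteq> \<Union> (set Vs) \<longleftrightarrow> e \<subseteq> insert x (\<Union> (set Vs))"
    if e': "e \<in> edges G" "\<not> e \<subseteq> insert x (last Vs - {z})" for e
  proof
    assume e: "e \<subseteq> insert x (\<Union> (set Vs))"
    obtain d where d: "d \<in> e" "d \<noteq> x" "d \<notin> last Vs - {z}" using e' by blast
    then have "closed_in G (\<Union> (set Vs)) d"
      using e assms smooth_prefix_closed[OF assms(1), of d] by (cases "d = z") auto
    then show "e \<subseteq> \<Union> (set Vs)" using d e' by (auto simp: closed_in_def)
  qed auto
  moreover have "\<not> e \<subseteq> insert x (last Vs - {z}) \<longleftrightarrow> \<not> e \<subseteq> last Vs - {z}"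
    if "e \<subseteq> \<Union> (set Vs)" for e
    using that assms(3) by auto
  moreover have "\<Union> (set (Vs @ [insert x (last Vs - {z})])) = insert x (\<Union> (set Vs))"
    using smooth_prefix_last[OF assms(1)] by auto
  ultimately show "edges (partial_graph G (Vs @ [insert x (last Vs - {z})])) =
    edges (Graph (insert x (\<Union> (set Vs)))
      {e \<in> edges G. e \<subseteq> \<Union> (set Vs) \<and> \<not> e \<subseteq> last Vs - {z}})"
    by (simp only: edges_partial_graph graph.sel last_snoc) blast
qed (use smooth_prefix_last[OF assms(1)] in auto)

section \<open>Renaming vertices\<close>

lemma inj_on_image_subset_eq:
  assumes "inj_on f C" "A \<subseteq> C" "B \<subseteq> C"
  shows "f ` A \<subseteq> f ` B \<longleftrightarrow> A \<subseteq> B"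
proof
  assume "f ` A \<subseteq> f ` B"
  show "A \<subseteq> B"
  proof
    fix a assume "a \<in> A"
    then have "f a \<in> f ` B" "a \<in> C" using \<open>f ` A \<subseteq> f ` B\<close> assms(2) by auto
    then show "a \<in> B" using inj_on_image_mem_iff[OF assms(1) _ assms(3)] by blast
  qed
qed auto

lemma closed_in_image:
  assumes "inj_on f (verts G)" "simple_graph G" "z \<in> verts G" "closed_in G S z"
  shows "closed_in (image_graph f G) (f ` S) (f z)"
  unfolding closed_in_def
proof (intro ballI impI)
  fix e assume "e \<in> edges (image_graph f G)" "f z \<in> e"
  then obtain e' where e': "e' \<in> edges G" "e = f ` e'" "f z \<in> f ` e'" by auto
  then have "z \<in> e'"
    using assms edge_subset_verts[OF assms(2) e'(1)] by (simp add: inj_on_image_mem_iff)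
  then show "e \<subseteq> f ` S" using e' assms(4) by (auto simp: closed_in_def)
qed

lemma completable_image:
  assumes "completable n G B D" "simple_graph G" "inj_on f (verts G)" "B \<subseteq> verts G" "D \<subseteq> verts G"
  shows "completable n (image_graph f G) (f ` B) (f ` D)"
  using assms
proof induction
  case (complete B D)
  then have "f ` verts G \<subseteq> f ` B \<union> f ` D" by blast
  then show ?case by (simp add: completable.complete)
next
  case (forget z B D)
  have "z \<in> verts G" using forget by auto
  then have 1: "f ` (B - {z}) = f ` B - {f z}"
    using forget.prems inj_on_image_set_diff[OF forget.prems(2), of B "{z}"] by auto
  have "completable n (image_graph f G) (f ` (B - {z})) (f ` insert z D)"
    using forget.prems \<open>z \<in> verts G\<close> by (intro forget.IH) auto
  moreover have "closed_in (image_graph f G) (f ` B \<union> f ` D) (f z)"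
    using closed_in_image[OF forget.prems(2,1) \<open>z \<in> verts G\<close> forget.hyps(2)]
    by (simp add: image_Un)
  ultimately show ?case
    using forget.hyps(1) 1 by - (rule completable.forget[of "f z"], auto)
next
  case (introduce x B D)
  have "f x \<notin> f ` (B \<union> D)"
    using introduce by (simp add: inj_on_image_mem_iff)
  moreover have "card (f ` B) < n"
    using introduce.hyps introduce.prems by (simp add: card_image inj_on_subset)
  moreover have "completable n (image_graph f G) (f ` insert x B) (f ` D)"
    using introduce.hyps introduce.prems by (intro introduce.IH) auto
  ultimately show ?case
    using introduce.hyps by - (rule completable.introduce[of "f x"], auto)
qed

lemma smooth_prefix_image:
  assumes "smooth_prefix k G Vs" "simple_graph G" "inj_on f (verts G)"
  shows "smooth_prefix k (image_graph f G) (map ((`) f) Vs)"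
  using assms
proof induction
  case (single U)
  then show ?case
    by (simp add: card_image inj_on_subset image_mono smooth_prefix.single)
next
  case (snoc Vs z x)
  have sub: "last Vs \<subseteq> \<Union> (set Vs)" "\<Union> (set Vs) \<subseteq> verts G"
    using smooth_prefix_last smooth_prefix_verts snoc.hyps(1) by blast+
  then have z: "z \<in> verts G" using snoc.hyps by blast
  have last: "last (map ((`) f) Vs) = f ` last Vs"
    using smooth_prefix_nonempty[OF snoc.hyps(1)] by (simp add: last_map)
  have union: "\<Union> (set (map ((`) f) Vs)) = f ` \<Union> (set Vs)" by auto
  have "f ` (last Vs - {z}) = f ` last Vs - {f z}"
    using sub z inj_on_image_set_diff[OF snoc.prems(2), of "last Vs" "{z}"] by auto
  then have eq: "map ((`) f) (Vs @ [insert x (last Vs - {z})]) =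
    map ((`) f) Vs @ [insert (f x) (last (map ((`) f) Vs) - {f z})]"
    using last by simp
  show ?case
    unfolding eq
  proof (rule smooth_prefix.snoc)
    show "smooth_prefix k (image_graph f G) (map ((`) f) Vs)"
      using snoc.IH snoc.prems by blast
    show "f z \<in> last (map ((`) f) Vs)" using snoc.hyps last by simp
    show "closed_in (image_graph f G) (\<Union> (set (map ((`) f) Vs))) (f z)"
      unfolding union by (rule closed_in_image[OF snoc.prems(2,1) z snoc.hyps(3)])
    have "f x \<notin> f ` \<Union> (set Vs)"
      using snoc.hyps sub snoc.prems by (metis DiffD1 DiffD2 inj_on_image_mem_iff)
    then show "f x \<in> verts (image_graph f G) - \<Union> (set (map ((`) f) Vs))"
      unfolding union using snoc.hyps by simp
  qed
qed

lemma partial_graph_image: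
  assumes "Vs \<noteq> []" "\<Union> (set Vs) \<subseteq> verts G" "simple_graph G" "inj_on f (verts G)"
  shows "partial_graph (image_graph f G) (map ((`) f) Vs) = image_graph f (partial_graph G Vs)"
proof (rule graph_eqI)
  have union: "\<Union> (set (map ((`) f) Vs)) = f ` \<Union> (set Vs)" by auto
  have last: "last (map ((`) f) Vs) = f ` last Vs" using assms(1) by (simp add: last_map)
  have "last Vs \<subseteq> verts G" using assms(1,2) last_in_set by blast
  then have *: "f ` e \<subseteq> f ` \<Union> (set Vs) \<longleftrightarrow> e \<subseteq> \<Union> (set Vs)"
    "f ` e \<subseteq> f ` last Vs \<longleftrightarrow> e \<subseteq> last Vs" if "e \<in> edges G" for e
    using inj_on_image_subset_eq[OF assms(4) edge_subset_verts[OF assms(3) that]] assms(2)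
    by blast+
  show "verts (partial_graph (image_graph f G) (map ((`) f) Vs)) =
      verts (image_graph f (partial_graph G Vs))"
    using union by simp
  show "edges (partial_graph (image_graph f G) (map ((`) f) Vs)) =
      edges (image_graph f (partial_graph G Vs))"
  proof (intro set_eqI iffI)
    fix e assume "e \<in> edges (partial_graph (image_graph f G) (map ((`) f) Vs))"
    then obtain e' where e': "e' \<in> edges G" "e = f ` e'"
        "f ` e' \<subseteq> f ` \<Union> (set Vs)" "\<not> f ` e' \<subseteq> f ` last Vs"
      unfolding edges_partial_graph edges_image_graph union last by blast
    then show "e \<in> edges (image_graph f (partial_graph G Vs))"
      unfolding edges_partial_graph edges_image_graph *[OF e'(1)] by blast
  next
    fix e assume "e \<in> edges (image_graph f (partial_graph G Vs))"
    then obtain e' where e': "e' \<in> edges G" "e = f ` e'" "e' \<subseteq> \<Union> (set Vs)" "\<not> e' \<subseteq> last Vs"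
      unfolding edges_partial_graph edges_image_graph by blast
    then show "e \<in> edges (partial_graph (image_graph f G) (map ((`) f) Vs))"
      unfolding edges_partial_graph edges_image_graph union last *[OF e'(1), symmetric] by blast
  qed
qed

section \<open>Pairs up to renaming\<close>

definition image_pair :: "('a \<Rightarrow> 'a) \<Rightarrow> 'a set \<times> 'a graph \<Rightarrow> 'a set \<times> 'a graph" where
  "image_pair f p = (f ` fst p, image_graph f (snd p))"

lemma pair_iso_iff: "pair_iso p q \<longleftrightarrow> (\<exists>f. inj_on f (verts (snd p)) \<and> q = image_pair f p)"
  by (cases q) (auto simp: pair_iso_def image_pair_def graph_iso_def bij_betw_def)

lemma image_pair_comp: "image_pair f (image_pair g p) = image_pair (f \<circ> g) p"
  by (simp add: image_pair_def image_graph_comp image_comp)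

lemma image_pair_id [simp]: "image_pair id p = p"
  by (simp add: image_pair_def)

lemma image_pair_cong:
  assumes "fst p \<subseteq> verts (snd p)" "\<Union> (edges (snd p)) \<subseteq> verts (snd p)"
    "\<And>x. x \<in> verts (snd p) \<Longrightarrow> f x = g x"
  shows "image_pair f p = image_pair g p"
proof -
  have "f ` fst p = g ` fst p" using assms by (intro image_cong) auto
  moreover have "image_graph f (snd p) = image_graph g (snd p)"
    using assms by (intro image_graph_cong) auto
  ultimately show ?thesis by (simp add: image_pair_def)
qed

text \<open>The pair \<open>(U', H')\<close> of \<open>neighbourhood_loop\<close>, where
  \<open>z\<close> is the replaced vertex and \<open>x\<close> the fresh one.\<close>

definition extend_pair ::
  "'a set \<Rightarrow> 'a graph \<Rightarrow> 'a \<Rightarrow> 'a \<Rightarrow> 'a set \<Rightarrow> 'a set \<times> 'a graph" where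
  "extend_pair U H x z Y =
     (insert x (U - {z}), add_edges (add_vertex H x) {{z, y} | y. y \<in> Y})"

lemma image_pair_extend:
  assumes "inj_on f U" "z \<in> U"
  shows "image_pair f (extend_pair U H x z Y) =
    extend_pair (f ` U) (image_graph f H) (f x) (f z) (f ` Y)"
proof -
  have "f ` (U - {z}) = f ` U - {f z}"
    using inj_on_image_set_diff[OF assms(1), of U "{z}"] assms(2) by auto
  moreover have "(`) f ` {{z, y} | y. y \<in> Y} = {{f z, y} | y. y \<in> f ` Y}"
    by (auto simp: image_iff) blast
  ultimately show ?thesis
    by (simp add: image_pair_def extend_pair_def graph_eqI image_Un)
qed

section \<open>Promising pairs\<close>

locale cubic_class =
  fixes \<G> \<U> :: "'a graph set" and k :: nat
  assumes infinite_type: "infinite (UNIV :: 'a set)"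
    and graph_class: "graph_class \<G>"
    and cubic: "\<forall>G\<in>\<G>. cubic G"
begin

text \<open>Only the prefix is fixed; \<open>completable\<close> stands for an unspecified
  continuation, which leaves the freedom to rearrange it.\<close>

definition witness :: "'a set \<times> 'a graph \<Rightarrow> 'a graph \<Rightarrow> 'a set list \<Rightarrow> bool" where
  "witness p G Vs \<longleftrightarrow> G \<in> \<G> - super \<U> \<and> smooth_prefix k G Vs \<and>
     completable (k + 1) G (last Vs) (\<Union> (set Vs) - last Vs) \<and> p = (last Vs, partial_graph G Vs)"

definition promising :: "'a set \<times> 'a graph \<Rightarrow> bool" where
  "promising p \<longleftrightarrow> (\<exists>G Vs. witness p G Vs)"

text \<open>The witness may be chosen separately for each \<open>z\<close>; the exchange in
  \<open>removable_degree_two\<close> makes use of this.\<close>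

definition removable :: "'a set \<times> 'a graph \<Rightarrow> 'a \<Rightarrow> bool" where
  "removable p z \<longleftrightarrow> (\<exists>G Vs. witness p G Vs \<and> \<not> verts G \<subseteq> \<Union> (set Vs) \<and>
     z \<in> last Vs \<and> closed_in G (\<Union> (set Vs)) z)"

lemma witness_simple: "witness p G Vs \<Longrightarrow> simple_graph G"
  using graph_class by (auto simp: witness_def graph_class_def)

lemma witness_image:
  assumes "witness p G Vs" "inj_on f (verts G)"
  shows "witness (image_pair f p) (image_graph f G) (map ((`) f) Vs)"
proof -
  have w: "G \<in> \<G> - super \<U>" "smooth_prefix k G Vs"
    "completable (k + 1) G (last Vs) (\<Union> (set Vs) - last Vs)" "p = (last Vs, partial_graph G Vs)"
    using assms(1) by (auto simp: witness_def)
  note simple = witness_simple[OF assms(1)]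
  have sub: "last Vs \<subseteq> \<Union> (set Vs)" "\<Union> (set Vs) \<subseteq> verts G"
    using smooth_prefix_last smooth_prefix_verts w(2) by blast+
  have ne: "Vs \<noteq> []" using smooth_prefix_nonempty w(2) by blast
  then have last: "last (map ((`) f) Vs) = f ` last Vs" by (simp add: last_map)
  have union: "\<Union> (set (map ((`) f) Vs)) = f ` \<Union> (set Vs)" by auto
  have diff: "f ` (\<Union> (set Vs) - last Vs) = f ` \<Union> (set Vs) - f ` last Vs"
    using sub by (intro inj_on_image_set_diff[OF assms(2)]) auto
  have "completable (k + 1) (image_graph f G) (f ` last Vs) (f ` (\<Union> (set Vs) - last Vs))"
    using sub by (intro completable_image[OF w(3) simple assms(2)]) auto
  then show ?thesis
    unfolding witness_def last union diff[symmetric]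
    using class_image[OF graph_class w(1) assms(2)] smooth_prefix_image[OF w(2) simple assms(2)]
      partial_graph_image[OF ne sub(2) simple assms(2)] w(4)
    by (simp add: image_pair_def)
qed

lemma witness_subset:
  assumes "witness p G Vs"
  shows "fst p \<subseteq> verts (snd p)" "\<Union> (edges (snd p)) \<subseteq> verts (snd p)" "verts (snd p) \<subseteq> verts G"
    "edges (snd p) \<subseteq> edges G"
  using assms smooth_prefix_last[of k G Vs] smooth_prefix_verts[of k G Vs]
  by (auto simp: witness_def)

text \<open>The image of a pair depends only on the values of \<open>f\<close> on its vertices, so
  \<open>f\<close> may be replaced by an extension that is injective on all of
  \<open>G\<close>.\<close>

lemma witness_image_extend:
  assumes "witness p G Vs" "inj_on f (verts (snd p))"
  obtains g where "inj_on g (verts G)" "\<And>x. x \<in> verts (snd p) \<Longrightarrow> g x = f x"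
    "witness (image_pair f p) (image_graph g G) (map ((`) g) Vs)"
proof -
  have "finite (verts G)" using witness_simple[OF assms(1)] by (simp add: simple_graph_def)
  then obtain g where g: "inj_on g (verts G)" "\<And>x. x \<in> verts (snd p) \<Longrightarrow> g x = f x"
    using inj_on_extend witness_subset(3)[OF assms(1)] assms(2) infinite_type by metis
  moreover have "image_pair g p = image_pair f p"
    using witness_subset[OF assms(1)] g(2) by (intro image_pair_cong) auto
  ultimately show thesis using that witness_image[OF assms(1) g(1)] by metis
qed

lemma promising_image:
  assumes "promising p" "inj_on f (verts (snd p))"
  shows "promising (image_pair f p)"
  using assms witness_image_extend unfolding promising_def by metis

lemma removable_image:
  assumes "removable p z" "inj_on f (verts (snd p))"
  shows "removable (image_pair f p) (f z)"
proof -
  obtain G Vs where w: "witness p G Vs" "\<not> verts G \<subseteq> \<Union> (set Vs)" "z \<in> last Vs"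
    "closed_in G (\<Union> (set Vs)) z"
    using assms(1) by (auto simp: removable_def)
  obtain g where g: "inj_on g (verts G)" "\<And>x. x \<in> verts (snd p) \<Longrightarrow> g x = f x"
    "witness (image_pair f p) (image_graph g G) (map ((`) g) Vs)"
    using witness_image_extend[OF w(1) assms(2)] by metis
  have union: "\<Union> (set (map ((`) g) Vs)) = g ` \<Union> (set Vs)" by auto
  have prefix: "smooth_prefix k G Vs" and p: "p = (last Vs, partial_graph G Vs)"
    using w(1) by (auto simp: witness_def)
  have zG: "z \<in> \<Union> (set Vs)" "\<Union> (set Vs) \<subseteq> verts G"
    using w(3) smooth_prefix_last[OF prefix] smooth_prefix_verts[OF prefix] by blast+
  then have "g z = f z" using g(2) p by simp
  moreover have "g z \<in> last (map ((`) g) Vs)"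
    using w(3) smooth_prefix_nonempty[OF prefix] by (simp add: last_map)
  moreover have "closed_in (image_graph g G) (g ` \<Union> (set Vs)) (g z)"
    using closed_in_image[OF g(1) witness_simple[OF w(1)]] w(4) zG by blast
  moreover have "\<not> verts (image_graph g G) \<subseteq> g ` \<Union> (set Vs)"
    using inj_on_image_subset_eq[OF g(1) order.refl zG(2)] w(2) by simp
  ultimately show ?thesis
    unfolding removable_def using g(3) union by metis
qed

text \<open>The bag forgets \<open>z\<close> and takes in some vertex \<open>x'\<close> that the
  completion allows. Afterwards \<open>x'\<close> is renamed to the prescribed
  \<open>x\<close>.\<close>

lemma removable_extend:
  assumes "removable (U, H) z" "x \<notin> verts H"
  shows "\<exists>Y\<subseteq>U - {z}. promising (extend_pair U H x z Y)"
proof -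
  obtain G Vs where w: "witness (U, H) G Vs" "\<not> verts G \<subseteq> \<Union> (set Vs)" "z \<in> last Vs"
    "closed_in G (\<Union> (set Vs)) z"
    using assms(1) by (auto simp: removable_def)
  then have G: "G \<in> \<G> - super \<U>" "smooth_prefix k G Vs"
    "completable (k + 1) G U (\<Union> (set Vs) - U)" and U: "last Vs = U" and H: "H = partial_graph G Vs"
    by (auto simp: witness_def)
  note simple = witness_simple[OF w(1)]
  have sub: "U \<subseteq> \<Union> (set Vs)" "\<Union> (set Vs) \<subseteq> verts G"
    using smooth_prefix_last[OF G(2)] smooth_prefix_verts[OF G(2)] U by auto
  have zU: "z \<in> U" using w(3) U by simp
  have eq: "U \<union> (\<Union> (set Vs) - U) = \<Union> (set Vs)"
    "U - {z} \<union> insert z (\<Union> (set Vs) - U) = \<Union> (set Vs)"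
    using sub zU by auto
  have "completable (k + 1) G (U - {z}) (insert z (\<Union> (set Vs) - U))"
    using G(3) zU w(4) eq by (intro completable_forget_closed) auto
  moreover have "card (U - {z}) < k + 1"
    using smooth_prefix_card[OF G(2) smooth_prefix_last_in_set[OF G(2)]] U zU by simp
  ultimately obtain x' where x': "x' \<in> verts G - \<Union> (set Vs)"
    "completable (k + 1) G (insert x' (U - {z})) (insert z (\<Union> (set Vs) - U))"
    using completable_introduce_some eq(2) w(2) by metis
  let ?Vs = "Vs @ [insert x' (last Vs - {z})]"
  \<comment> \<open>The edges at \<open>z\<close> inside the bag become edges of the associated
    graph as soon as \<open>z\<close> leaves.\<close>
  let ?Y = "{y \<in> U - {z}. {z, y} \<in> edges G}"
  have prefix: "smooth_prefix k G ?Vs"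
    using G(2) w(3,4) x' by (intro smooth_prefix.snoc) auto
  have "\<Union> (set ?Vs) - last ?Vs = insert z (\<Union> (set Vs) - U)"
    using sub zU x' U by auto
  then have "witness (last ?Vs, partial_graph G ?Vs) G ?Vs"
    using G prefix x' U by (simp add: witness_def)
  moreover have "partial_graph G ?Vs = add_edges (add_vertex H x') {{z, y} | y. y \<in> ?Y}"
  proof -
    have "e \<in> {{z, y} | y. y \<in> ?Y}" if "e \<in> edges G" "e \<subseteq> U" "\<not> e \<subseteq> U - {z}" for e
    proof -
      from that(1) obtain a b where "e = {a, b}" "a \<noteq> b"
        using simple unfolding simple_graph_def by meson
      moreover from this have "z = a \<or> z = b" using that(2,3) by blast
      ultimately obtain y where "e = {z, y}" "y \<noteq> z" by blast
      then show ?thesis using that by blast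
    qed
    then have "{e \<in> edges G. e \<subseteq> \<Union> (set Vs) \<and> \<not> e \<subseteq> U - {z}} =
      {e \<in> edges G. e \<subseteq> \<Union> (set Vs) \<and> \<not> e \<subseteq> U} \<union> {{z, y} | y. y \<in> ?Y}"
      using sub zU by blast
    moreover have "partial_graph G ?Vs = Graph (insert x' (\<Union> (set Vs)))
      {e \<in> edges G. e \<subseteq> \<Union> (set Vs) \<and> \<not> e \<subseteq> U - {z}}"
      using partial_graph_snoc[OF G(2) w(4), of x'] x'(1) U by simp
    ultimately show ?thesis
      using H U by (intro graph_eqI) simp_all
  qed
  ultimately have prom: "promising (extend_pair U H x' z ?Y)"
    unfolding promising_def extend_pair_def using U by auto
  \<comment> \<open>This only has to be injective on the vertices of the extended pair: should
    \<open>x\<close> occur elsewhere in \<open>G\<close>, \<open>promising_image\<close> renames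
    that vertex as well.\<close>
  define f where "f = id (x' := x)"
  have fid: "f y = y" if "y \<in> verts H" for y
    using that x'(1) H by (auto simp: f_def)
  have fidU: "f y = y" if "y \<in> U" for y
  proof -
    have "y \<in> verts H" using that sub(1) H by auto
    then show ?thesis by (rule fid)
  qed
  have "inj_on f (insert x' (verts H))"
    using assms(2) fid by (auto simp: inj_on_def f_def)
  then have "promising (image_pair f (extend_pair U H x' z ?Y))"
    using prom by (intro promising_image) (auto simp: extend_pair_def)
  also have "image_pair f (extend_pair U H x' z ?Y) =
      extend_pair (f ` U) (image_graph f H) (f x') (f z) (f ` ?Y)"
    using fidU zU by (intro image_pair_extend) (simp_all add: inj_on_def)
  also have "f ` U = U" using fidU by (simp add: image_def)
  also have "f ` ?Y = ?Y" using fidU by (auto simp: image_iff)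
  also have "f z = z" using fidU zU by simp
  also have "f x' = x" by (simp add: f_def)
  also have "image_graph f H = image_graph id H"
    using fid H by (intro image_graph_cong) auto
  also have "\<dots> = H" by simp
  finally have "promising (extend_pair U H x z ?Y)" .
  moreover have "?Y \<subseteq> U - {z}" by auto
  ultimately show ?thesis by (intro exI[of _ ?Y] conjI)
qed

lemma removable_degree_two:
  assumes wit: "witness (U, H) G Vs" and rest: "\<not> verts G \<subseteq> \<Union> (set Vs)"
    and y: "y \<in> U" and deg: "degree H y \<ge> 2"
  shows "removable (U, H) y"
proof (cases "closed_in G (\<Union> (set Vs)) y")
  case True
  then show ?thesis using assms unfolding removable_def witness_def by blast
next
  case False
  have G: "G \<in> \<G> - super \<U>" "smooth_prefix k G Vs"
    "completable (k + 1) G U (\<Union> (set Vs) - U)" and U: "last Vs = U" and H: "H = partial_graph G Vs"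
    using wit by (auto simp: witness_def)
  note simple = witness_simple[OF wit]
  obtain e where e: "e \<in> edges G" "y \<in> e" "\<not> e \<subseteq> \<Union> (set Vs)"
    using False by (auto simp: closed_in_def)
  have "finite (edges G)"
  proof (rule finite_subset)
    show "edges G \<subseteq> Pow (verts G)" using edge_subset_verts[OF simple] by blast
    show "finite (Pow (verts G))" using simple by (simp add: simple_graph_def)
  qed
  then have fin: "finite {e \<in> edges G. y \<in> e}" by simp
  have sub: "U \<subseteq> \<Union> (set Vs)" "\<Union> (set Vs) \<subseteq> verts G"
    using smooth_prefix_last[OF G(2)] smooth_prefix_verts[OF G(2)] U by auto
  then have "card {e \<in> edges G. y \<in> e} = 3"
    using y G(1) cubic by (auto simp: cubic_def degree_def)
  then have "card ({e \<in> edges G. y \<in> e} - {e}) = 2" using e by simp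
  moreover have "{e \<in> edges H. y \<in> e} \<subseteq> {e \<in> edges G. y \<in> e} - {e}" using e H by auto
  \<comment> \<open>\<open>e\<close> is not in \<open>H\<close>, and \<open>G\<close> has just two
    further edges at \<open>y\<close>. Since \<open>H\<close> has at least two edges at
    \<open>y\<close>, these are the same, and \<open>e\<close> is the only missing one.\<close>
  ultimately have others: "{e \<in> edges H. y \<in> e} = {e \<in> edges G. y \<in> e} - {e}"
    using deg fin by (intro card_subset_eq) (auto simp: degree_def intro: antisym card_mono
      dest: card_mono[rotated])
  from e(1) obtain a b where "e = {a, b}" "a \<in> verts G" "b \<in> verts G"
    using simple unfolding simple_graph_def by meson
  moreover have "y \<in> \<Union> (set Vs)" using y sub by blast
  ultimately obtain w where w: "e = {y, w}" "w \<in> verts G - \<Union> (set Vs)" using e by auto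
  from G(2) show ?thesis
  proof cases
    case (single U')
    then have "edges H = {}" using H by auto
    then show ?thesis using deg by (simp add: degree_def)
  next
    case (snoc Vs' z x)
    define A where "A = last Vs' - {z}"
    define S where "S = \<Union> (set Vs')"
    have prefix': "smooth_prefix k G Vs'" by fact
    have UA: "U = insert x A" and Vs: "Vs = Vs' @ [insert x A]"
      using U snoc by (auto simp: A_def)
    have AS: "A \<subseteq> S" "z \<in> S" "z \<notin> A" "x \<notin> S" "S \<subseteq> verts G" "x \<in> verts G"
      using snoc smooth_prefix_last[OF prefix'] smooth_prefix_verts[OF prefix']
      by (auto simp: A_def S_def)
    have union: "\<Union> (set Vs) = insert x S" using Vs AS by (auto simp: S_def)
    have H': "H = Graph (insert x S) {e \<in> edges G. e \<subseteq> S \<and> \<not> e \<subseteq> A}"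
      using partial_graph_snoc[OF prefix', of z x] snoc H by (simp add: A_def S_def)
    \<comment> \<open>The vertex introduced last is isolated in \<open>H\<close>.\<close>
    have "y \<noteq> x"
    proof
      assume "y = x"
      then have "{e \<in> edges H. y \<in> e} = {}" using AS H' by auto
      then have "degree H y = 0" unfolding degree_def by (simp only: card.empty)
      then show False using deg by simp
    qed
    then have yA: "y \<in> A" using y UA by simp
    have wx: "w \<noteq> x" "w \<notin> S" "w \<noteq> y" "w \<in> verts G" using w union yA AS by auto
    have closed: "closed_in G (insert w S) y"
      unfolding closed_in_def
    proof (intro ballI impI)
      fix e' assume "e' \<in> edges G" "y \<in> e'"
      then have "e' = e \<or> e' \<in> edges H" using others by blast
      then show "e' \<subseteq> insert w S" using w yA AS H' by auto
    qed
    define D where "D = S - A"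
    have D: "\<Union> (set Vs) - U = D" using union UA AS by (auto simp: D_def)
    \<comment> \<open>This is the state in which \<open>w\<close> has taken the place of
      \<open>y\<close> in \<open>U\<close>. It is also reached from the bag
      \<open>insert w A\<close> by forgetting \<open>y\<close> and then introducing
      \<open>x\<close>, so that bag is completable too.\<close>
    have "completable (k + 1) G (insert w (U - {y})) (insert y D)"
    proof (rule completable_replace_by_neighbour)
      show "completable (k + 1) G U D" using G(3) D by simp
      have "U \<union> D = insert x S" using UA AS by (auto simp: D_def)
      then show "w \<in> verts G - (U \<union> D)" "closed_in G (insert w (U \<union> D)) y"
        using wx closed by (auto simp: closed_in_def)
    qed (use y w e in auto)
    moreover have "insert w (U - {y}) = insert x (insert w (A - {y}))"
      using UA \<open>y \<noteq> x\<close> by auto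
    ultimately have "completable (k + 1) G (insert x (insert w (A - {y}))) (insert y D)" by simp
    moreover have "card (insert w (A - {y})) < k + 1"
    proof -
      have "card U = k + 1"
        using smooth_prefix_card[OF G(2) smooth_prefix_last_in_set[OF G(2)]] U by simp
      moreover from this have "finite U" using card.infinite by fastforce
      moreover have "x \<notin> A" using AS by blast
      ultimately have "card A = k" "finite A" using UA by auto
      then have "card (A - {y}) < k" using yA by (metis card_Diff1_less)
      then show ?thesis using \<open>finite A\<close> by (simp add: card_insert_if)
    qed
    moreover have "x \<in> verts G - (insert w (A - {y}) \<union> insert y D)"
      using AS wx \<open>y \<noteq> x\<close> by (auto simp: D_def)
    ultimately have "completable (k + 1) G (insert w (A - {y})) (insert y D)"
      by - (rule completable.introduce[of x])
    moreover have "insert w (A - {y}) = insert w A - {y}" using wx by auto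
    moreover have "insert w A \<union> D = insert w S" using AS by (auto simp: D_def)
    ultimately have comp: "completable (k + 1) G (insert w A) D"
      using yA closed by - (rule completable.forget[of y], auto)
    \<comment> \<open>The alternative prefix, in which the last step introduces \<open>w\<close>
      instead of \<open>x\<close>.\<close>
    let ?Vs = "Vs' @ [insert w A]"
    have prefix: "smooth_prefix k G ?Vs"
      using smooth_prefix.snoc[of k G Vs' z w] snoc wx by (simp add: A_def S_def)
    have union': "\<Union> (set ?Vs) = insert w S" using AS by (auto simp: S_def)
    have D': "insert w S - insert w A = D" using wx by (auto simp: D_def)
    have "witness (last ?Vs, partial_graph G ?Vs) G ?Vs"
      unfolding witness_def union' using G(1) prefix comp D' by simp
    \<comment> \<open>The edges are those of \<open>H\<close>: the two pairs differ only in the name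
      of an isolated vertex.\<close>
    moreover have "partial_graph G ?Vs = Graph (insert w S) {e \<in> edges G. e \<subseteq> S \<and> \<not> e \<subseteq> A}"
      using partial_graph_snoc[OF prefix', of z w] snoc wx by (simp add: A_def S_def)
    moreover have "\<not> verts G \<subseteq> insert w S" using AS wx by blast
    ultimately have rem: "removable
        (insert w A, Graph (insert w S) {e \<in> edges G. e \<subseteq> S \<and> \<not> e \<subseteq> A}) y"
      unfolding removable_def using closed yA union'
      by (intro exI[of _ G] exI[of _ ?Vs]) simp
    \<comment> \<open>Swapping the names \<open>w\<close> and \<open>x\<close> turns the alternative
      pair into \<open>(U, H)\<close> and fixes \<open>y\<close>.\<close>
    define t where "t = Transposition.transpose w x"
    have t: "t a = a" if "a \<in> S" for a
      using that AS wx by (auto simp: t_def Transposition.transpose_def)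
    have tS: "t ` B = B" if "B \<subseteq> S" for B
    proof -
      have "t ` B = id ` B" using that t by (intro image_cong) auto
      then show ?thesis by simp
    qed
    have "t w = x" by (simp add: t_def)
    then have "image_pair t
        (insert w A, Graph (insert w S) {e \<in> edges G. e \<subseteq> S \<and> \<not> e \<subseteq> A}) = (U, H)"
    proof -
      have "(`) t ` {e \<in> edges G. e \<subseteq> S \<and> \<not> e \<subseteq> A} = id ` {e \<in> edges G. e \<subseteq> S \<and> \<not> e \<subseteq> A}"
        using tS by (intro image_cong) auto
      then show ?thesis
        using tS[of A] tS[of S] AS UA H' \<open>t w = x\<close> by (simp add: image_pair_def image_graph_def)
    qed
    moreover have "t y = y" using t yA AS by blast
    moreover have inj: "inj_on t T" for T by (simp add: t_def)
    ultimately show ?thesis using removable_image[OF rem inj] by simp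
  qed
qed

text \<open>The bag is full and vertices are missing, so the completion begins by forgetting some
  vertex, and that vertex is removable.\<close>

lemma removable_exists:
  assumes "witness (U, H) G Vs" "\<not> verts G \<subseteq> \<Union> (set Vs)"
  shows "\<exists>z\<in>U. removable (U, H) z"
proof -
  have w: "smooth_prefix k G Vs" "completable (k + 1) G U (\<Union> (set Vs) - U)" "last Vs = U"
    using assms(1) by (auto simp: witness_def)
  have eq: "U \<union> (\<Union> (set Vs) - U) = \<Union> (set Vs)" using smooth_prefix_last[OF w(1)] w(3) by auto
  have card: "card U = k + 1"
    using smooth_prefix_card[OF w(1) smooth_prefix_last_in_set[OF w(1)]] w(3) by simp
  from w(2) obtain z where "z \<in> U" "closed_in G (\<Union> (set Vs)) z"
    unfolding eq by cases (use assms(2) eq card in auto)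
  then show ?thesis using assms w(3) unfolding removable_def by blast
qed

section \<open>Promising pairs and the tests of the algorithm\<close>

lemma promising_not_super:
  assumes "promising p"
  shows "snd p \<notin> super \<U>"
proof
  assume s: "snd p \<in> super \<U>"
  obtain G Vs where w: "witness p G Vs" using assms by (auto simp: promising_def)
  have "G \<in> super \<U>"
    using super_mono[OF s witness_simple[OF w]] witness_subset[OF w] by blast
  then show False using w by (simp add: witness_def)
qed

lemma promising_contains_pair:
  assumes "promising p"
  shows "\<exists>G\<in>\<G> - super \<U>. contains_pair k G p"
proof -
  obtain G Vs where w: "witness p G Vs" using assms by (auto simp: promising_def)
  then show ?thesis
    using smooth_prefix_contains_pair[OF witness_simple[OF w], of k Vs]
    by (auto simp: witness_def)
qed

lemma promising_not_good:
  assumes "promising p"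
  shows "\<not> good_pair k \<G> \<U> p"
proof -
  obtain G where G: "G \<in> \<G> - super \<U>" "contains_pair k G p"
    using promising_contains_pair[OF assms] by blast
  then obtain Vs where "smooth_path_decomposition k G Vs" by (auto simp: contains_pair_def)
  then have "path_width G \<le> k"
    by (intro path_width_le[of G Vs]) (auto simp: smooth_path_decomposition_def)
  then show ?thesis using G by (auto simp: good_pair_def class_pw_def)
qed

text \<open>A one-bag prefix has an edgeless associated graph, and any two edgeless pairs on full
  bags agree up to renaming.\<close>

lemma promising_initial:
  assumes "G \<in> class_pw \<G> k - super \<U>" "k + 1 \<le> card (verts G)" "card V = k + 1"
  shows "promising (V, Graph V {})"
proof -
  have G: "simple_graph G" "path_width G \<le> k" "G \<in> \<G> - super \<U>"
    using assms(1) graph_class by (auto simp: class_pw_def graph_class_def)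
  then obtain U where U: "U \<subseteq> verts G" "card U = k + 1" "completable (k + 1) G U {}"
    using completable_initial assms(2) by blast
  then have "witness (U, Graph U {}) G [U]"
    using G by (auto simp: witness_def partial_graph_def intro: smooth_prefix.single)
  then have prom: "promising (U, Graph U {})" by (auto simp: promising_def)
  have "finite U" "finite V" using U(2) assms(3) card.infinite by fastforce+
  then obtain f where "bij_betw f U V" using finite_same_card_bij U(2) assms(3) by metis
  then show ?thesis
    using promising_image[OF prom, of f]
    by (auto simp: bij_betw_def image_pair_def image_graph_def)
qed

end

section \<open>Automorphisms\<close>

lemma AutD:
  assumes "\<phi> \<in> Aut U H"
  shows "bij \<phi>" "image_graph \<phi> H = H" "\<phi> ` U = U" "x \<notin> verts H \<Longrightarrow> \<phi> x = x"
  using assms permutes_bij permutes_not_in unfolding Aut_def graph_iso_def by auto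

lemma Aut_image_pair: "\<phi> \<in> Aut U H \<Longrightarrow> image_pair \<phi> (U, H) = (U, H)"
  by (simp add: image_pair_def AutD(2,3))

lemma inv_bij_comp: "bij f \<Longrightarrow> inv f \<circ> f = id"
  by (simp add: bij_is_inj)

lemma (in cubic_class) promising_extend_Aut:
  assumes "\<phi> \<in> Aut U H" "\<phi> z = z" "z \<in> U" "x \<notin> verts H"
    "promising (extend_pair U H x z (\<phi> ` Y))"
  shows "promising (extend_pair U H x z Y)"
proof -
  note \<phi> = AutD[OF assms(1)]
  have "inj_on \<phi> U" using \<phi>(1) bij_is_inj inj_on_subset by blast
  then have "image_pair \<phi> (extend_pair U H x z Y) = extend_pair U H x z (\<phi> ` Y)"
    using image_pair_extend[of \<phi> U z H x Y] assms \<phi> by simp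
  then have "image_pair (inv \<phi>) (extend_pair U H x z (\<phi> ` Y)) = extend_pair U H x z Y"
    by (metis image_pair_comp image_pair_id inv_bij_comp \<phi>(1))
  moreover have "inj_on (inv \<phi>) A" for A
    using bij_imp_bij_inv[OF \<phi>(1)] bij_is_inj inj_on_subset by blast
  ultimately show ?thesis using promising_image[OF assms(5)] by metis
qed

section \<open>The loops of the algorithm\<close>

lemma edge_loop_Some:
  "edge_loop \<G> \<U> U H F r \<Longrightarrow> r = Some G \<Longrightarrow> \<exists>E\<in>F. G = add_edges H E \<and> G \<in> \<G> - super \<U>"
  by (induction rule: edge_loop.induct) auto

text \<open>A discarded set is the image of a tested set \<open>E'\<close> under an automorphism of
  \<open>H\<close>, so it yields a graph isomorphic to \<open>add_edges H E'\<close>, which has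
  failed the test.\<close>

lemma edge_loop_None:
  assumes "edge_loop \<G> \<U> U H F r" "r = None" "graph_class \<G>" "E \<in> F"
  shows "add_edges H E \<notin> \<G> - super \<U>"
  using assms
proof induction
  case (continue E' F r)
  show ?case
  proof (cases "E = E' \<or> E \<in> F - {E'} - {(`) \<phi> ` E' | \<phi>. \<phi> \<in> Aut U H}")
    case True
    then show ?thesis
    proof
      assume "E = E'"
      then show ?thesis using continue.hyps(2) by simp
    next
      assume "E \<in> F - {E'} - {(`) \<phi> ` E' | \<phi>. \<phi> \<in> Aut U H}"
      then show ?thesis using continue.IH continue.prems(1,2) by blast
    qed
  next
    case False
    then obtain \<phi> where \<phi>: "\<phi> \<in> Aut U H" "E = (`) \<phi> ` E'" using continue.prems by blast
    note \<phi>' = AutD[OF \<phi>(1)]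
    have "image_graph \<phi> (add_edges H E') = add_edges (image_graph \<phi> H) E"
      using \<phi>(2) by (intro graph_eqI) (simp_all add: image_Un)
    then have "image_graph (inv \<phi>) (add_edges H E) = add_edges H E'"
      by (metis image_graph_comp image_graph_id inv_bij_comp \<phi>'(1,2))
    moreover have "inj_on (inv \<phi>) A" for A
      using bij_imp_bij_inv[OF \<phi>'(1)] bij_is_inj inj_on_subset by blast
    ultimately show ?thesis
      using class_image[OF continue.prems(2)] continue.hyps(2) by metis
  qed
qed auto

lemma set_queue_update:
  "set Q \<subseteq> set (queue_update k \<G> \<U> p Q)" "set (queue_update k \<G> \<U> p Q) \<subseteq> insert p (set Q)"
  by (auto simp: queue_update_def)

lemma neighbourhood_loop_mono:
  "neighbourhood_loop k \<G> \<U> U H x z \<Y> Q Q' \<Longrightarrow> set Q \<subseteq> set Q'"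
proof (induction rule: neighbourhood_loop.induct)
  case (continue Y \<Y> U' H' Q Q')
  then show ?case using set_queue_update(1) by blast
qed auto

lemma neighbourhood_loop_invariant:
  assumes "neighbourhood_loop k \<G> \<U> U H x z \<Y> Q Q'"
    "\<And>Y. Y \<in> \<Y> \<Longrightarrow> P (extend_pair U H x z Y)" "\<And>p. p \<in> set Q \<Longrightarrow> P p" "q \<in> set Q'"
  shows "P q"
  using assms
proof (induction rule: neighbourhood_loop.induct)
  case (continue Y \<Y> U' H' Q Q')
  show ?case
  proof (rule continue.IH)
    fix p assume "p \<in> set (queue_update k \<G> \<U> (U', H') Q)"
    then have "p = extend_pair U H x z Y \<or> p \<in> set Q"
      using set_queue_update(2) continue.hyps(2,3) unfolding extend_pair_def by blast
    then show "P p" using continue.prems(1,2) continue.hyps(1) by blast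
  qed (use continue.prems in auto)
qed auto

lemma vertex_loop_mono:
  "vertex_loop k \<G> \<U> U H x W Q Q' \<Longrightarrow> set Q \<subseteq> set Q'"
proof (induction rule: vertex_loop.induct)
  case (continue z W Q Q' Q'')
  then show ?case using neighbourhood_loop_mono[OF continue.hyps(2)] by blast
qed auto

lemma vertex_loop_invariant:
  assumes "vertex_loop k \<G> \<U> U H x W Q Q'"
    "\<And>z Y. z \<in> W \<Longrightarrow> Y \<subseteq> U - {z} \<Longrightarrow> P (extend_pair U H x z Y)"
    "\<And>p. p \<in> set Q \<Longrightarrow> P p" "q \<in> set Q'"
  shows "P q"
  using assms
proof (induction rule: vertex_loop.induct)
  case (continue z W Q Q' Q'')
  show ?case
  proof (rule continue.IH)
    fix p assume p: "p \<in> set Q'"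
    show "P p"
      by (rule neighbourhood_loop_invariant[OF continue.hyps(2) _ _ p])
         (use continue.prems continue.hyps(1) in auto)
  qed (use continue.prems in auto)
qed auto

context cubic_class
begin

text \<open>A promising pair passes the first two tests. It can be rejected only because of an
  isomorphic pair in the queue, which is then promising itself.\<close>

lemma queue_update_promising:
  assumes "promising p"
  shows "\<exists>q\<in>set (queue_update k \<G> \<U> p Q). promising q"
proof (cases "\<exists>q\<in>set Q. pair_iso p q")
  case True
  then obtain q where q: "q \<in> set Q" "pair_iso p q" by blast
  then have "promising q" using promising_image[OF assms] by (auto simp: pair_iso_iff)
  then show ?thesis using q(1) set_queue_update(1) by blast
next
  case False
  then have "queue_update k \<G> \<U> p Q = Q @ [p]"
    using promising_not_super[OF assms] promising_contains_pair[OF assms]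
    unfolding queue_update_def by auto
  then show ?thesis using assms by auto
qed

lemma neighbourhood_loop_promising:
  assumes "neighbourhood_loop k \<G> \<U> U H x z \<Y> Q Q'" "z \<in> U" "x \<notin> verts H"
    "Y \<in> \<Y>" "promising (extend_pair U H x z Y)"
  shows "\<exists>q\<in>set Q'. promising q"
  using assms
proof (induction arbitrary: Y rule: neighbourhood_loop.induct)
  case (continue Y0 \<Y> U' H' Q Q')
  show ?case
  proof (cases "Y \<in> \<Y> - {Y0} - {\<phi> ` Y0 | \<phi>. \<phi> \<in> Aut U H \<and> \<phi> z = z}")
    case True
    then show ?thesis using continue.IH continue.prems by blast
  next
    case False
    \<comment> \<open>Now \<open>Y\<close> is \<open>Y0\<close> or its image under an automorphism
      fixing \<open>z\<close>.\<close>
    then have "promising (extend_pair U H x z Y0)"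
      using continue.prems promising_extend_Aut by blast
    then have "promising (U', H')" using continue.hyps(2,3) by (simp add: extend_pair_def)
    from queue_update_promising[OF this, of Q] show ?thesis
      using neighbourhood_loop_mono[OF continue.hyps(4)] by blast
  qed
qed auto

lemma vertex_loop_promising:
  assumes "vertex_loop k \<G> \<U> U H x W Q Q'" "W \<subseteq> U" "x \<notin> verts H"
    "z \<in> W" "Y \<subseteq> U - {z}" "promising (extend_pair U H x z Y)"
  shows "\<exists>q\<in>set Q'. promising q"
  using assms
proof (induction rule: vertex_loop.induct)
  case (continue y W Q Q' Q'')
  show ?case
  proof (cases "z = y")
    case True
    then have "\<exists>q\<in>set Q'. promising q"
      using continue.prems continue.hyps(1)
      by (intro neighbourhood_loop_promising[OF continue.hyps(2)]) auto
    then show ?thesis using vertex_loop_mono[OF continue.hyps(3)] by blast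
  next
    case False
    then show ?thesis using continue.prems by (intro continue.IH) auto
  qed
qed auto

text \<open>If the bag has a vertex of degree at least 2, every such vertex is removable, so an
  arbitrary choice is safe. Otherwise an automorphism carries some removable vertex to the
  representative of its orbit.\<close>

lemma branching_set_removable:
  assumes "branching_set U H W" "witness (U, H) G Vs" "\<not> verts G \<subseteq> \<Union> (set Vs)"
  shows "\<exists>z\<in>W. removable (U, H) z"
proof (cases "\<exists>z\<in>U. degree H z \<ge> 2")
  case True
  then obtain z where "z \<in> U" "degree H z \<ge> 2" "W = {z}"
    using assms(1) unfolding branching_set_def by auto
  then show ?thesis using removable_degree_two[OF assms(2,3)] by blast
next
  case False
  then have rep: "orbit_representatives U H W" using assms(1) unfolding branching_set_def by auto
  obtain z where z: "z \<in> U" "removable (U, H) z" using removable_exists[OF assms(2,3)] by blast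
  then obtain \<phi> where \<phi>: "\<phi> \<in> Aut U H" "\<phi> z \<in> W"
    using rep unfolding orbit_representatives_def Aut_orbit_def by blast
  have "inj_on \<phi> (verts H)" using AutD(1)[OF \<phi>(1)] bij_is_inj inj_on_subset by blast
  then show ?thesis
    using removable_image[OF z(2), of \<phi>] Aut_image_pair[OF \<phi>(1)] \<phi>(2) by auto
qed

end

lemma branching_set_subset: "branching_set U H W \<Longrightarrow> W \<subseteq> U"
  by (auto simp: branching_set_def orbit_representatives_def split: if_splits)

section \<open>Pairs constructed by the algorithm\<close>

text \<open>The first part records the names in use and yields freshness of the next one. The second
  gives a decomposition with last bag \<open>U\<close>, so edges inside \<open>U\<close> can be
  added without raising the path-width above \<open>k\<close>.\<close>

definition constructed :: "nat \<Rightarrow> (nat \<Rightarrow> 'a) \<Rightarrow> (nat \<Rightarrow> 'a) \<Rightarrow> 'a set \<times> 'a graph \<Rightarrow> bool" where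
  "constructed k u v p \<longleftrightarrow> (\<exists>i. verts (snd p) = u ` {1..k} \<union> v ` {1..i}) \<and>
     (\<exists>Vs. Vs \<noteq> [] \<and> path_decomposition (snd p) Vs \<and> (\<forall>B\<in>set Vs. card B \<le> k + 1) \<and>
       last Vs = fst p)"

lemma card_names:
  assumes "inj u" "inj v" "range u \<inter> range v = {}"
  shows "card (u ` {1..k} \<union> v ` {1..i}) = k + i"
proof -
  have "u ` {1..k} \<inter> v ` {1..i} = {}" using assms(3) by blast
  then show ?thesis
    using assms(1,2) by (simp add: card_Un_disjoint card_image inj_on_subset)
qed

text \<open>The names are distinct, so the index computed from \<open>card (verts H)\<close> is
  exactly the number of names \<open>v 1, v 2, \<dots>\<close> in use.\<close>

lemma constructed_fresh:
  assumes "inj u" "inj v" "range u \<inter> range v = {}" "constructed k u v (U, H)"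
    "i = card (verts H) - k"
  shows "verts H = u ` {1..k} \<union> v ` {1..i}" "v (i + 1) \<notin> verts H"
proof -
  obtain j where "verts H = u ` {1..k} \<union> v ` {1..j}"
    using assms(4) by (auto simp: constructed_def)
  then show H: "verts H = u ` {1..k} \<union> v ` {1..i}"
    using card_names[OF assms(1-3), of k j] assms(5) by simp
  have "v (i + 1) \<notin> v ` {1..i}" using assms(2) by (auto dest: injD)
  then show "v (i + 1) \<notin> verts H" using assms(3) H by blast
qed

text \<open>The new bag is appended to the decomposition. The added edges join \<open>z\<close> to
  vertices of \<open>U\<close>, so they lie in the previous last bag.\<close>

lemma constructed_extend:
  assumes "inj u" "inj v" "range u \<inter> range v = {}" "constructed k u v (U, H)"
    "i = card (verts H) - k" "z \<in> U" "Y \<subseteq> U - {z}"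
  shows "constructed k u v (extend_pair U H (v (i + 1)) z Y)"
proof -
  let ?x = "v (i + 1)"
  let ?H = "add_edges (add_vertex H ?x) {{z, y} | y. y \<in> Y}"
  note H = constructed_fresh[OF assms(1-5)]
  obtain Vs where Vs: "Vs \<noteq> []" "path_decomposition H Vs" "\<forall>B\<in>set Vs. card B \<le> k + 1"
    "last Vs = U"
    using assms(4) by (auto simp: constructed_def)
  have last: "U \<in> set Vs" using Vs(1,4) last_in_set by blast
  have union: "\<Union> (set Vs) = verts H" and int: "interval_bags Vs"
    and edges: "\<forall>e\<in>edges H. \<exists>B\<in>set Vs. e \<subseteq> B"
    using Vs(2) by (simp_all add: path_decomposition_iff)
  have "finite U" using last union H(1) by (metis Sup_upper finite_UnI finite_atLeastAtMost
        finite_imageI finite_subset)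
  then have "card (insert ?x (U - {z})) \<le> Suc (card (U - {z}))" by (simp add: card_insert_if)
  also have "\<dots> = card U" using \<open>finite U\<close> assms(6) by (intro card_Suc_Diff1)
  finally have card: "card (insert ?x (U - {z})) \<le> k + 1" using Vs(3) last by fastforce
  have UH: "U \<subseteq> verts H" using last union by blast
  have "path_decomposition ?H (Vs @ [insert ?x (U - {z})])"
    unfolding path_decomposition_iff
  proof (intro conjI ballI)
    show "\<Union> (set (Vs @ [insert ?x (U - {z})])) = verts ?H"
      using union UH by auto
    show "interval_bags (Vs @ [insert ?x (U - {z})])"
      using int Vs(1,4) H(2) union by (intro interval_bags_append) auto
    fix e assume "e \<in> edges ?H"
    then consider "e \<in> edges H" | "e \<subseteq> U" using assms(6,7) by auto
    then show "\<exists>B\<in>set (Vs @ [insert ?x (U - {z})]). e \<subseteq> B"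
    proof cases
      case 1
      then obtain B where "B \<in> set Vs" "e \<subseteq> B" using edges by blast
      then show ?thesis by auto
    next
      case 2
      then show ?thesis using last by auto
    qed
  qed
  moreover have "verts ?H = u ` {1..k} \<union> v ` {1..i + 1}"
    using H(1) by (simp add: atLeastAtMostSuc_conv)
  ultimately show ?thesis
    unfolding constructed_def extend_pair_def using Vs(3) card
    by (intro conjI exI[of _ "i + 1"] exI[of _ "Vs @ [insert ?x (U - {z})]"]) auto
qed

lemma vertex_loop_constructed:
  assumes "inj u" "inj v" "range u \<inter> range v = {}" "constructed k u v (U, H)"
    "branching_set U H W" "\<forall>p\<in>set Q. constructed k u v p"
    "vertex_loop k \<G> \<U> U H (v (card (verts H) - k + 1)) W Q Q'"
  shows "\<forall>p\<in>set Q'. constructed k u v p"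
proof
  fix p assume "p \<in> set Q'"
  show "constructed k u v p"
  proof (rule vertex_loop_invariant[OF assms(7) _ _ \<open>p \<in> set Q'\<close>])
    fix z Y assume "z \<in> W" "Y \<subseteq> U - {z}"
    then show "constructed k u v (extend_pair U H (v (card (verts H) - k + 1)) z Y)"
      using branching_set_subset[OF assms(5)] constructed_extend[OF assms(1-4) refl] by blast
  qed (use assms(6) in auto)
qed

lemma constructed_path_width:
  assumes "constructed k u v (U, H)" "E \<subseteq> {{x, y} | x y. x \<in> U \<and> y \<in> U \<and> x \<noteq> y}"
  shows "path_width (add_edges H E) \<le> k"
proof -
  obtain Vs where Vs: "Vs \<noteq> []" "path_decomposition H Vs" "\<forall>B\<in>set Vs. card B \<le> k + 1"
    "last Vs = U"
    using assms(1) by (auto simp: constructed_def)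
  have "U \<in> set Vs" using Vs(1,4) last_in_set by blast
  moreover have "e \<subseteq> U" if "e \<in> E" for e using that assms(2) by blast
  ultimately have "path_decomposition (add_edges H E) Vs"
    using Vs(2) unfolding path_decomposition_iff by auto
  then show ?thesis
    using path_width_le width_le_iff Vs(1,3) by blast
qed

section \<open>Outcomes of the main loop\<close>

lemma main_loop_Some:
  assumes "main_loop k \<G> \<U> v Q r" "r = Some G" "\<forall>p\<in>set Q. constructed k u v p"
    "inj u" "inj v" "range u \<inter> range v = {}"
  shows "G \<in> class_pw \<G> k - super \<U>"
  using assms
proof induction
  case (return U H G' Q1 Q2)
  from edge_loop_Some[OF return.hyps refl] obtain E
    where "E \<subseteq> {{x, y} | x y. x \<in> U \<and> y \<in> U \<and> x \<noteq> y}" "G' = add_edges H E" "G' \<in> \<G> - super \<U>"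
    by blast
  then show ?case
    using constructed_path_width return.prems by (auto simp: class_pw_def)
next
  case (continue U H i W Q1 Q2 Q' r)
  have "\<forall>p\<in>set Q'. constructed k u v p"
    by (rule vertex_loop_constructed[OF continue.prems(3-5) _ continue.hyps(3) _
          continue.hyps(4)[unfolded continue.hyps(2)]])
       (use continue.prems(2) in auto)
  then show ?case using continue.IH continue.prems by blast
qed auto

text \<open>The claim is made for all pairs in the queue. A pair not processed now survives in
  \<open>Q'\<close> by \<open>vertex_loop_mono\<close>, and a processed promising pair would put a
  promising pair into \<open>Q'\<close>.\<close>

lemma (in cubic_class) main_loop_None:
  assumes "main_loop k \<G> \<U> v Q r" "r = None" "\<forall>p\<in>set Q. constructed k u v p"
    "inj u" "inj v" "range u \<inter> range v = {}" "p \<in> set Q"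
  shows "\<not> promising p"
  using assms
proof (induction arbitrary: p)
  case (continue U H i W Q1 Q2 Q' r)
  have con: "constructed k u v (U, H)" using continue.prems(2) by simp
  have "\<forall>p\<in>set Q'. constructed k u v p"
    by (rule vertex_loop_constructed[OF continue.prems(3-5) con continue.hyps(3) _
          continue.hyps(4)[unfolded continue.hyps(2)]])
       (use continue.prems(2) in auto)
  then have IH: "\<not> promising q" if "q \<in> set Q'" for q
    using continue.IH continue.prems that by blast
  show ?case
  proof (cases "p = (U, H)")
    case False
    then have "p \<in> set (Q1 @ Q2)" using continue.prems by auto
    then show ?thesis using IH vertex_loop_mono[OF continue.hyps(4)] by blast
  next
    case True
    show ?thesis
    proof
      assume "promising p"
      then obtain G Vs where w: "witness (U, H) G Vs" using True by (auto simp: promising_def)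
      note simple = witness_simple[OF w]
      \<comment> \<open>Otherwise \<open>G\<close> itself would be \<open>H\<close> plus edges
        inside \<open>U\<close>, a graph ruled out by the outcome \<open>None\<close> of the edge
        loop.\<close>
      have "\<not> verts G \<subseteq> \<Union> (set Vs)"
      proof
        assume *: "verts G \<subseteq> \<Union> (set Vs)"
        define E where "E = {e \<in> edges G. e \<subseteq> U}"
        have H: "H = partial_graph G Vs" "U = last Vs" "smooth_prefix k G Vs" "G \<in> \<G> - super \<U>"
          using w by (auto simp: witness_def)
        have "\<Union> (set Vs) = verts G" using * smooth_prefix_verts[OF H(3)] by blast
        then have "G = add_edges H E"
          using H(1,2) edge_subset_verts[OF simple] by (intro graph_eqI) (auto simp: E_def)
        moreover have "E \<in> Pow {{x, y} | x y. x \<in> U \<and> y \<in> U \<and> x \<noteq> y}"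
        proof (rule PowI, rule subsetI)
          fix e assume e: "e \<in> E"
          then have "e \<in> edges G" by (simp add: E_def)
          then obtain x y where "x \<noteq> y" "e = {x, y}"
            using simple unfolding simple_graph_def by meson
          then show "e \<in> {{x, y} | x y. x \<in> U \<and> y \<in> U \<and> x \<noteq> y}"
            using e unfolding E_def by blast
        qed
        ultimately show False
          using edge_loop_None[OF continue.hyps(1) refl graph_class] H(4) by blast
      qed
      then obtain z where z: "z \<in> W" "removable (U, H) z"
        using branching_set_removable[OF continue.hyps(3) w] by blast
      have fresh: "v (i + 1) \<notin> verts H"
        using constructed_fresh(2)[OF continue.prems(3-5) con continue.hyps(2)] .
      obtain Y where "Y \<subseteq> U - {z}" "promising (extend_pair U H (v (i + 1)) z Y)"
        using removable_extend[OF z(2) fresh] by blast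
      from vertex_loop_promising[OF continue.hyps(4) branching_set_subset[OF continue.hyps(3)]
          fresh z(1) this]
      show False using IH by blast
    qed
  qed
qed auto

theorem theorem12:
  fixes k :: nat and \<G> \<U> :: "'a graph set" and u v :: "nat \<Rightarrow> 'a"
  assumes "inj u" and "inj v" and "range u \<inter> range v = {}"
    and "graph_class \<G>"
    and "\<forall>G\<in>\<G>. cubic G"
    and "\<forall>G\<in>\<G>. card (verts G) \<ge> k + 1"
    and "finite \<U>" and "\<forall>F\<in>\<U>. simple_graph F"
  shows "(\<forall>G. algorithm_returns k \<G> \<U> u v (Some G) \<longrightarrow> G \<in> class_pw \<G> k - super \<U>) \<and>
    (algorithm_returns k \<G> \<U> u v None \<longrightarrow> class_pw \<G> k \<subseteq> super \<U>)"
proof -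
  interpret cubic_class \<G> \<U> k
  proof
    show "infinite (UNIV :: 'a set)"
      using assms(1) finite_imageD[of u UNIV] finite_subset[of "range u" UNIV] by auto
  qed (fact assms)+
  define V where "V = insert (v 1) (u ` {1..k})"
  have V: "V = u ` {1..k} \<union> v ` {1..1}" by (auto simp: V_def)
  then have card: "card V = k + 1" using card_names[OF assms(1-3), of k 1] by simp
  have queue: "initial_queue k \<G> \<U> u v =
      (if good_pair k \<G> \<U> (V, Graph V {}) then [] else [(V, Graph V {})])"
    by (simp add: initial_queue_def V_def Let_def)
  have "constructed k u v (V, Graph V {})"
    unfolding constructed_def using V card
    by (intro conjI exI[of _ 1] exI[of _ "[V]"])
       (auto simp: path_decomposition_iff interval_bags_def)
  then have con: "\<forall>p\<in>set (initial_queue k \<G> \<U> u v). constructed k u v p"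
    by (simp add: queue)
  have "G \<in> super \<U>" if none: "algorithm_returns k \<G> \<U> u v None" and G: "G \<in> class_pw \<G> k" for G
  proof (rule ccontr)
    assume "G \<notin> super \<U>"
    \<comment> \<open>A counterexample makes the initial pair promising, hence not good, so it is in
      the initial queue; this contradicts \<open>main_loop_None\<close>.\<close>
    with G have prom: "promising (V, Graph V {})"
      using assms(6) card by (intro promising_initial[of G]) (auto simp: class_pw_def)
    then have "(V, Graph V {}) \<in> set (initial_queue k \<G> \<U> u v)"
      using promising_not_good by (simp add: queue)
    then show False
      using main_loop_None[OF none[unfolded algorithm_returns_def] refl con assms(1-3)] prom by blast
  qed
  moreover have "G \<in> class_pw \<G> k - super \<U>" if "algorithm_returns k \<G> \<U> u v (Some G)" for G
    using main_loop_Some[OF that[unfolded algorithm_returns_def] refl con assms(1-3)] .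
  ultimately show ?thesis by blast
qed

end
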